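(* Let $H>0$ and $t>0$, and let $f:\mathbb{R}\to\mathbb{R}$ be a continuous function that satisfies a uniform $\rho_t(H)$-circle under condition. Let $\Omega=\mathbb{R}\times(-h_t(H),h_t(H))$, and let $u$ and $v$ be two solutions on $\Omega$ of the constant mean curvature equation $$\operatorname{div}\left(\frac{\nabla u}{\sqrt{1+|\nabla u|^2}}\right)=2H$$ both with boundary value $\phi_f$, where $\phi_f(x,\pm h_t(H))=f(x)$ for $x\in\mathbb{R}$. Then $u=v$.
   Context: A solution of the equation on $\Omega$ with boundary value $\phi_f$ is a function that is continuous on $\overline{\Omega}$, smooth (classical solution, $C^2$) in $\Omega$, satisfies the equation in $\Omega$, and equals $\phi_f$ on $\partial\Omega$. No growth or boundedness condition at infinity is imposed. For $H>0$ and $t>0$ define $$\rho_t(H)=\sqrt{\frac{Ht^2+t}{H}},\qquad h_t(H)=\int_t^{\rho}\frac{H(\rho^2-x^2)}{\sqrt{x^2-H^2(\rho^2-x^2)^2}}\,dx\quad\text{with }\rho=\rho_t(H).$$ (One has $0<h_t(H)<\frac{1}{2H}$.) A domain $U\subset\mathbb{R}^2$ satisfies a uniform exterior $R$-circle condition if at each point $p\in\partial U$ there exists a disk $D$ of radius $R$ such that $\overline{D}\cap\overline{U}=\{p\}$. A continuous function $f:\mathbb{R}\to\mathbb{R}$ satisfies a uniform $R$-circle under condition if $\{(x,y)\in\mathbb{R}^2 : y\ge f(x)\}$ satisfies a uniform exterior $R$-circle condition. *)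

theory Defs
  imports "HOL-Analysis.Analysis"
begin

definition rho :: "real \<Rightarrow> real \<Rightarrow> real" where
  "rho t H = sqrt ((H * t\<^sup>2 + t) / H)"

text \<open>
  The integrand has an integrable singularity at the left end point, where the
  root vanishes; its value there is irrelevant to the integral.
\<close>

definition half_width :: "real \<Rightarrow> real \<Rightarrow> real" where
  "half_width t H =
     integral {t..rho t H}
       (\<lambda>x. H * ((rho t H)\<^sup>2 - x\<^sup>2) / sqrt (x\<^sup>2 - H\<^sup>2 * ((rho t H)\<^sup>2 - x\<^sup>2)\<^sup>2))"

text \<open>
  Stated for arbitrary sets, because the circle-under condition applies it to a closed region.
\<close>

definition uniform_exterior_circle :: "real \<Rightarrow> (real \<times> real) set \<Rightarrow> bool" where
  "uniform_exterior_circle R U \<longleftrightarrow>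
     (\<forall>p\<in>frontier U. \<exists>c. cball c R \<inter> closure U = {p})"

definition uniform_circle_under :: "real \<Rightarrow> (real \<Rightarrow> real) \<Rightarrow> bool" where
  "uniform_circle_under R f \<longleftrightarrow> uniform_exterior_circle R {(x, y). y \<ge> f x}"

definition grad :: "('a::real_inner \<Rightarrow> real) \<Rightarrow> 'a \<Rightarrow> 'a" where
  "grad u p = (THE D. GDERIV u p :> D)"

definition divergence :: "('a::euclidean_space \<Rightarrow> 'a) \<Rightarrow> 'a \<Rightarrow> real" where
  "divergence F p = (\<Sum>b\<in>Basis. frechet_derivative F (at p) b \<bullet> b)"

text \<open>
  Twice continuously differentiable on an open set: the gradient exists and has a derivative
  (the Hessian, as a bounded linear map) that depends continuously on the point.
\<close>

definition C2_on :: "('a::euclidean_space) set \<Rightarrow> ('a \<Rightarrow> real) \<Rightarrow> bool" where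
  "C2_on S u \<longleftrightarrow>
     (\<exists>G (A :: 'a \<Rightarrow> 'a \<Rightarrow>\<^sub>L 'a).
        (\<forall>p\<in>S. GDERIV u p :> G p) \<and>
        (\<forall>p\<in>S. (G has_derivative blinfun_apply (A p)) (at p)) \<and>
        continuous_on S A)"

definition cmc_equation_on :: "real \<Rightarrow> (real \<times> real) set \<Rightarrow> (real \<times> real \<Rightarrow> real) \<Rightarrow> bool" where
  "cmc_equation_on H S u \<longleftrightarrow>
     (\<forall>p\<in>S. divergence (\<lambda>q. (1 / sqrt (1 + (norm (grad u q))\<^sup>2)) *\<^sub>R grad u q) p = 2 * H)"

text \<open>
  Classical solutions of the Dirichlet problem. Values outside \<^term>\<open>closure \<Omega>\<close> are
  unconstrained.
\<close>

definition cmc_solution ::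
    "real \<Rightarrow> (real \<times> real) set \<Rightarrow> (real \<times> real \<Rightarrow> real) \<Rightarrow> (real \<times> real \<Rightarrow> real) \<Rightarrow> bool" where
  "cmc_solution H \<Omega> \<phi> u \<longleftrightarrow>
     continuous_on (closure \<Omega>) u \<and> C2_on \<Omega> u \<and> cmc_equation_on H \<Omega> u \<and>
     (\<forall>p\<in>frontier \<Omega>. u p = \<phi> p)"

end

theory Submission
  imports Defs
begin

text \<open>
  Write \<open>\<phi> = u - v\<close> and \<open>X\<close> for the difference of the horizontal parts of the unit normals of the
  two graphs. Then \<open>X\<close> is divergence free, \<open>\<nabla>\<phi> \<bullet> X \<ge> \<bar>X\<bar>\<^sup>2\<close>, and testing with \<open>\<kappa> \<chi>(\<phi>)\<close> for a
  bounded increasing \<open>\<chi>\<close> and a cutoff \<open>\<kappa>\<close> bounds the energy \<open>\<chi>'(\<phi>) \<nabla>\<phi> \<bullet> X\<close> by the flux lost in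
  the cutoff at each of the two ends. This flux tends to 0 along a suitable sequence of cutoffs in
  each of three cases: if \<open>\<phi>\<close> is bounded on slabs going to infinity, cut off there in \<open>x\<close>; if \<open>v\<close>
  grows superlinearly on slabs going to infinity, take a function of \<open>v\<close> as cutoff, which
  works because \<open>\<nabla>v \<bullet> X \<le> 1\<close>; if \<open>- u\<close> does, take a function of \<open>u\<close>. One of the cases always
  occurs: hemispheres bound \<open>u\<close> from above by the maximum of \<open>f\<close> over a window, the nodoids over
  the exterior discs bound \<open>v\<close> from below by \<open>f\<close> on a nearby slab, and if \<open>f\<close> has no far away
  near-maxima over windows then it grows or decays superlinearly.
\<close>

section \<open>The unit normal of a graph\<close>

text \<open>The obstacle is that a strip is borderline: a cutoff in \<open>x\<close> over a slab of
  length L has slope of order 1/L and acts on an area of order L, so \<open>|X| \<le> 2\<close>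
  alone only makes the energy finite. Each case supplies the missing gain: for bounded
  \<open>\<phi>\<close>, Young's inequality trades flux for energy, whose tail is small; superlinear
  growth outruns the area. The bound on \<open>\<nabla>v \<bullet> X\<close> is one-sided and holds
  for arbitrarily steep graphs, which is why fluxes are estimated from one side only. Gradients may
  blow up at the edges, so \<open>\<chi>\<close> vanishes below a level \<open>d > 0\<close>, and
  \<open>d\<close> tends to 0 at the end. The barriers need no prior bound on the solutions: on the
  sides of their domains inside the strip they have vertical tangents, and a differentiable function
  cannot touch them there. The constants of the statement come from the nodoid: its neck has radius
  \<open>t\<close>, and at distance \<open>half_width t H\<close> from the neck its profile reaches
  radius \<open>rho t H\<close>, that of the exterior discs. Its bounding circles thus lie over the
  edges, where the discs control \<open>f\<close>.\<close>

definition nmap :: "'a::real_inner \<Rightarrow> 'a" where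
  "nmap q = (1 / sqrt (1 + (norm q)\<^sup>2)) *\<^sub>R q"

lemma norm_nmap_le: "norm (nmap q) \<le> 1"
proof -
  have "norm q \<le> sqrt (1 + (norm q)\<^sup>2)"
    by (rule real_le_rsqrt) simp
  moreover have "0 < sqrt (1 + (norm q)\<^sup>2)"
    by (simp add: add_pos_nonneg)
  ultimately show ?thesis
    by (simp add: nmap_def)
qed

text \<open>By Cauchy-Schwarz the left side is at most \<open>|q| (W - |q|) / W\<close>, where
  \<open>|q| \<le> W\<close> and \<open>W - |q| \<le> 1\<close>. The bound is uniform in
  \<open>p\<close> and \<open>q\<close>, which makes functions of a solution usable as cutoffs
  however steep it is.\<close>

lemma inner_nmap_diff_le: "q \<bullet> (nmap p - nmap q) \<le> 1"
proof -
  define W where "W = sqrt (1 + (norm q)\<^sup>2)"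
  have W: "W\<^sup>2 = 1 + (norm q)\<^sup>2" "W > 0"
    by (simp_all add: W_def add_pos_nonneg)
  have Wle: "W \<le> 1 + norm q"
    unfolding W_def by (rule real_le_lsqrt) (auto simp: power2_eq_square algebra_simps)
  have Wge: "norm q \<le> W"
    unfolding W_def by (rule real_le_rsqrt) simp
  have "q \<bullet> nmap p \<le> norm q * 1"
    by (meson Cauchy_Schwarz_ineq2 abs_le_D1 mult_left_mono norm_ge_zero norm_nmap_le order_trans)
  moreover have "q \<bullet> nmap q = (norm q)\<^sup>2 / W"
    by (simp add: nmap_def W_def power2_norm_eq_inner)
  moreover have "norm q - (norm q)\<^sup>2 / W \<le> 1"
  proof -
    have "norm q * (W - norm q) \<le> W * 1"
      by (rule mult_mono) (use Wle Wge W in auto)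
    then show ?thesis
      using W(2) by (simp add: field_simps power2_eq_square)
  qed
  ultimately show ?thesis
    by (simp add: inner_diff_right)
qed

text \<open>
  The left-hand side is the squared distance of the unit normals of the two graphs, weighted by the
  mean of the area elements.
\<close>

lemma nmap_monotone_identity:
  fixes p q :: "'a::real_inner"
  defines "a \<equiv> sqrt (1 + (norm p)\<^sup>2)" and "b \<equiv> sqrt (1 + (norm q)\<^sup>2)"
  shows "(a + b) / 2 * ((norm (nmap p - nmap q))\<^sup>2 + (1 / a - 1 / b)\<^sup>2)
    = (p - q) \<bullet> (nmap p - nmap q)"
proof -
  have a: "a > 0" "p \<bullet> p = a * a - 1"
    by (simp_all add: a_def add_pos_nonneg power2_norm_eq_inner flip: power2_eq_square)
  have b: "b > 0" "q \<bullet> q = b * b - 1"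
    by (simp_all add: b_def add_pos_nonneg power2_norm_eq_inner flip: power2_eq_square)
  have *: "nmap p = (1 / a) *\<^sub>R p" "nmap q = (1 / b) *\<^sub>R q"
    by (simp_all add: nmap_def a_def b_def)
  have "(norm (nmap p - nmap q))\<^sup>2
      = (1 / a) * (1 / a) * (p \<bullet> p) + (1 / b) * (1 / b) * (q \<bullet> q) - 2 * (1 / a) * (1 / b) * (p \<bullet> q)"
    unfolding * power2_norm_eq_inner by (simp add: inner_diff inner_commute algebra_simps)
  moreover have "(p - q) \<bullet> (nmap p - nmap q)
      = (1 / a) * (p \<bullet> p) + (1 / b) * (q \<bullet> q) - (p \<bullet> q) * (1 / a + 1 / b)"
    unfolding * by (simp add: inner_diff inner_commute algebra_simps)
  \<comment> \<open>The reciprocals become variables tied by \<open>a * x = 1\<close> and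
    \<open>b * y = 1\<close>, so that the remaining identity is polynomial.\<close>
  moreover obtain x y where x: "1 / a = x" "a * x = 1" and y: "1 / b = y" "b * y = 1"
    using a(1) b(1) by simp
  moreover have "(a + b) * (x * x * (a * a - 1) + y * y * (b * b - 1) - 2 * x * y * s + (x - y)\<^sup>2)
      = 2 * (x * (a * a - 1) + y * (b * b - 1) - s * (x + y))" for s
    using x(2) y(2) by algebra
  ultimately show ?thesis
    using a(2) b(2) by simp
qed

lemma nmap_monotone: "(norm (nmap p - nmap q))\<^sup>2 \<le> (p - q) \<bullet> (nmap p - nmap q)"
proof -
  define a where "a = sqrt (1 + (norm p)\<^sup>2)"
  define b where "b = sqrt (1 + (norm q)\<^sup>2)"
  have "a \<ge> 1" "b \<ge> 1"
    by (simp_all add: a_def b_def)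
  then have "1 * (norm (nmap p - nmap q))\<^sup>2
      \<le> (a + b) / 2 * ((norm (nmap p - nmap q))\<^sup>2 + (1 / a - 1 / b)\<^sup>2)"
    by (intro mult_mono) auto
  then show ?thesis
    using nmap_monotone_identity[of p q] by (simp add: a_def b_def)
qed

lemma nmap_monotone_strict:
  assumes "(p - q) \<bullet> (nmap p - nmap q) = 0"
  shows "p = q"
proof -
  define a where "a = sqrt (1 + (norm p)\<^sup>2)"
  define b where "b = sqrt (1 + (norm q)\<^sup>2)"
  have ab: "a > 0" "b > 0"
    by (simp_all add: a_def b_def add_pos_nonneg)
  have "(a + b) / 2 * ((norm (nmap p - nmap q))\<^sup>2 + (1 / a - 1 / b)\<^sup>2) = 0"
    using assms nmap_monotone_identity[of p q] by (simp add: a_def b_def)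
  then have "(norm (nmap p - nmap q))\<^sup>2 + (1 / a - 1 / b)\<^sup>2 = 0"
    using ab by simp
  then have "nmap p = nmap q" "1 / a = 1 / b"
    by (simp_all add: add_nonneg_eq_0_iff)
  moreover have "nmap p = (1 / a) *\<^sub>R p" "nmap q = (1 / b) *\<^sub>R q"
    by (simp_all add: nmap_def a_def b_def)
  ultimately show ?thesis
    using ab by simp
qed

definition dnmap :: "'a::real_inner \<Rightarrow> 'a \<Rightarrow> 'a" where
  "dnmap q e = (1 / sqrt (1 + (norm q)\<^sup>2)) *\<^sub>R e - ((q \<bullet> e) / sqrt (1 + (norm q)\<^sup>2) ^ 3) *\<^sub>R q"

lemma has_derivative_nmap:
  assumes "(G has_derivative B) (at p within S)"
  shows "((\<lambda>x. nmap (G x)) has_derivative (\<lambda>e. dnmap (G p) (B e))) (at p within S)"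
proof -
  have pos: "1 + G p \<bullet> G p > 0"
    by (simp add: add_pos_nonneg)
  have 1: "((\<lambda>x. 1 + G x \<bullet> G x) has_derivative (\<lambda>e. 2 * (G p \<bullet> B e))) (at p within S)"
    by (rule derivative_eq_intros assms refl)+ (simp add: inner_commute)
  have "((\<lambda>z. inverse (sqrt z)) has_real_derivative
      - (inverse (sqrt (1 + G p \<bullet> G p)) ^ 3 / 2)) (at (1 + G p \<bullet> G p))"
    using pos by (auto intro!: derivative_eq_intros simp: power3_eq_cube)
  from has_derivative_compose[OF 1 has_field_derivative_imp_has_derivative[OF this]]
  have 2: "((\<lambda>x. inverse (sqrt (1 + G x \<bullet> G x))) has_derivative
      (\<lambda>e. - (inverse (sqrt (1 + G p \<bullet> G p)) ^ 3 / 2) * (2 * (G p \<bullet> B e)))) (at p within S)" .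
  have "((\<lambda>x. inverse (sqrt (1 + G x \<bullet> G x)) *\<^sub>R G x) has_derivative (\<lambda>e. dnmap (G p) (B e))) (at p within S)"
    using has_derivative_scaleR[OF 2 assms]
    by (simp add: dnmap_def power2_norm_eq_inner inverse_eq_divide power_one_over)
  then show ?thesis
    unfolding nmap_def power2_norm_eq_inner by (simp add: inverse_eq_divide)
qed

lemma continuous_on_nmap [continuous_intros]:
  assumes "continuous_on S G"
  shows "continuous_on S (\<lambda>x. nmap (G x))"
proof -
  have "1 + (norm q)\<^sup>2 \<noteq> 0" for q :: 'b
    by (smt (verit) zero_le_power2)
  then show ?thesis
    unfolding nmap_def by (intro continuous_intros assms) simp
qed

lemma continuous_on_dnmap [continuous_intros]:
  assumes "continuous_on S G" "continuous_on S E"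
  shows "continuous_on S (\<lambda>x. dnmap (G x) (E x))"
proof -
  have "1 + (norm q)\<^sup>2 \<noteq> 0" for q :: 'b
    by (smt (verit) zero_le_power2)
  then show ?thesis
    unfolding dnmap_def by (intro continuous_intros assms) simp_all
qed

section \<open>Classical solutions and the mean curvature operator at a point\<close>

lemma GDERIV_unique:
  assumes "GDERIV u p :> D" "GDERIV u p :> D'"
  shows "D = D'"
proof -
  have "(\<lambda>h. h \<bullet> D) = (\<lambda>h. h \<bullet> D')"
    using assms has_derivative_unique unfolding gderiv_def by blast
  then show ?thesis
    by (metis inner_commute vector_eq_ldot)
qed

lemma grad_eq: "GDERIV u p :> D \<Longrightarrow> grad u p = D"
  unfolding grad_def using GDERIV_unique by blast

text \<open>Continuity of the Hessian is asked for one direction at a time; this is enough for the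
  integrals and keeps bounded linear maps out of the rest.\<close>

definition graph_on :: "('a::euclidean_space) set \<Rightarrow> ('a \<Rightarrow> real) \<Rightarrow> ('a \<Rightarrow> 'a) \<Rightarrow> ('a \<Rightarrow> 'a \<Rightarrow> 'a) \<Rightarrow> bool" where
  "graph_on S u G B \<longleftrightarrow>
     (\<forall>p\<in>S. GDERIV u p :> G p) \<and> (\<forall>p\<in>S. (G has_derivative B p) (at p)) \<and>
     (\<forall>e. continuous_on S (\<lambda>p. B p e))"

lemma graph_on_continuous:
  assumes "graph_on S u G B"
  shows "continuous_on S G" and "continuous_on S u"
proof -
  show "continuous_on S G"
    using assms unfolding graph_on_def
    by (intro continuous_at_imp_continuous_on ballI) (auto dest!: bspec has_derivative_continuous)
  show "continuous_on S u"
    using assms unfolding graph_on_def gderiv_def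
    by (intro continuous_at_imp_continuous_on ballI) (auto dest!: bspec has_derivative_continuous)
qed

text \<open>The mean curvature operator in non-divergence form. It depends only on the gradient
  \<open>q\<close> and the Hessian \<open>B\<close> at one point, so that comparison at a contact
  point becomes linear algebra.\<close>

definition graph_div :: "('a::euclidean_space) \<Rightarrow> ('a \<Rightarrow> 'a) \<Rightarrow> real" where
  "graph_div q B = (\<Sum>b\<in>Basis. dnmap q (B b) \<bullet> b)"

lemma cmc_graph_on:
  assumes "open S" "C2_on S u" "cmc_equation_on H S u"
  obtains G B where "graph_on S u G B" "\<And>p. p \<in> S \<Longrightarrow> graph_div (G p) (B p) = 2 * H"
proof -
  obtain G A where G: "\<And>p. p \<in> S \<Longrightarrow> GDERIV u p :> G p"
    and A: "\<And>p. p \<in> S \<Longrightarrow> (G has_derivative blinfun_apply (A p)) (at p)"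
    and cA: "continuous_on S A"
    using assms(2) unfolding C2_on_def by blast
  have "graph_on S u G (\<lambda>p. blinfun_apply (A p))"
    unfolding graph_on_def using G A cA by (auto intro!: continuous_intros)
  moreover have "graph_div (G p) (blinfun_apply (A p)) = 2 * H" if p: "p \<in> S" for p
  proof -
    have 1: "((\<lambda>q. nmap (G q)) has_derivative (\<lambda>e. dnmap (G p) (A p e))) (at p)"
      by (rule has_derivative_nmap[OF A[OF p]])
    have 2: "\<And>q. q \<in> S \<Longrightarrow> nmap (G q) = (1 / sqrt (1 + (norm (grad u q))\<^sup>2)) *\<^sub>R grad u q"
      using grad_eq[OF G] by (simp add: nmap_def)
    have "((\<lambda>q. (1 / sqrt (1 + (norm (grad u q))\<^sup>2)) *\<^sub>R grad u q)
        has_derivative (\<lambda>e. dnmap (G p) (A p e))) (at p)"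
      by (rule has_derivative_transform_within_open[OF 1 assms(1) p 2])
    then have 3: "frechet_derivative (\<lambda>q. (1 / sqrt (1 + (norm (grad u q))\<^sup>2)) *\<^sub>R grad u q) (at p)
        = (\<lambda>e. dnmap (G p) (A p e))"
      by (simp add: frechet_derivative_at[symmetric])
    show ?thesis
      using bspec[OF assms(3)[unfolded cmc_equation_on_def divergence_def] p]
      unfolding 3 graph_div_def .
  qed
  ultimately show thesis
    by (rule that)
qed

lemma sum_Basis_real_prod: "(\<Sum>b\<in>(Basis :: (real \<times> real) set). F b) = F (1, 0) + F (0, 1)"
  by (simp add: Basis_prod_def sum.union_disjoint add.commute)

section \<open>Integration and cutoff functions\<close>

text \<open>Fubini in both orders and the fundamental theorem of calculus on each line, whose two
  end values vanish by \<open>bdry\<close>.\<close>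

lemma integral_divergence_zero:
  fixes F :: "real \<times> real \<Rightarrow> real \<times> real"
  assumes ab: "a \<le> b" "c \<le> d"
    and der: "\<And>p. p \<in> cbox (a, c) (b, d) \<Longrightarrow> (F has_derivative D p) (at p)"
    and cont: "\<And>e. continuous_on (cbox (a, c) (b, d)) (\<lambda>p. D p e)"
    and bdry: "\<And>p. p \<in> cbox (a, c) (b, d) \<Longrightarrow>
      fst p = a \<or> fst p = b \<or> snd p = c \<or> snd p = d \<Longrightarrow> F p = 0"
  shows "integral (cbox (a, c) (b, d)) (\<lambda>p. fst (D p (1, 0)) + snd (D p (0, 1))) = 0"
proof -
  let ?B = "cbox (a, c) (b, d)"
  have c1: "continuous_on ?B (\<lambda>p. fst (D p (1, 0)))"
    by (intro continuous_intros cont)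
  have c2: "continuous_on ?B (\<lambda>p. snd (D p (0, 1)))"
    by (intro continuous_intros cont)
  have 1: "integral (cbox a b) (\<lambda>x. fst (D (x, y) (1, 0))) = 0" if y: "y \<in> cbox c d" for y
  proof -
    have "((\<lambda>x. fst (F (x, y))) has_vector_derivative fst (D (x, y) (1, 0))) (at x within {a..b})"
      if x: "x \<in> {a..b}" for x
    proof -
      have F: "(F has_derivative D (x, y)) (at (x, y))"
        using der x y by auto
      have "((\<lambda>x. (x, y)) has_derivative (\<lambda>h. (h, 0))) (at x within {a..b})"
        by (auto intro!: derivative_eq_intros)
      from has_derivative_compose[OF this F]
      have "((\<lambda>x. fst (F (x, y))) has_derivative (\<lambda>h. fst (D (x, y) (h, 0)))) (at x within {a..b})"
        by (rule has_derivative_fst)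
      moreover have eq: "(\<lambda>h. fst (D (x, y) (h, 0))) = (\<lambda>h. h *\<^sub>R fst (D (x, y) (1, 0)))" (is "?l = ?r")
      proof
        fix h
        show "?l h = ?r h"
          using linear_scale[OF has_derivative_linear[OF F], of h "(1, 0)"] by simp
      qed
      ultimately show ?thesis
        unfolding has_vector_derivative_def eq by simp
    qed
    from fundamental_theorem_of_calculus[OF ab(1) this]
    have "((\<lambda>x. fst (D (x, y) (1, 0))) has_integral fst (F (b, y)) - fst (F (a, y))) {a..b}"
      by blast
    moreover have "F (b, y) = 0" "F (a, y) = 0"
      using bdry[of "(b, y)"] bdry[of "(a, y)"] y ab by auto
    ultimately show ?thesis
      by (simp add: integral_unique)
  qed
  have 2: "integral (cbox c d) (\<lambda>y. snd (D (x, y) (0, 1))) = 0" if x: "x \<in> cbox a b" for x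
  proof -
    have "((\<lambda>y. snd (F (x, y))) has_vector_derivative snd (D (x, y) (0, 1))) (at y within {c..d})"
      if y: "y \<in> {c..d}" for y
    proof -
      have F: "(F has_derivative D (x, y)) (at (x, y))"
        using der x y by auto
      have "((\<lambda>y. (x, y)) has_derivative (\<lambda>h. (0, h))) (at y within {c..d})"
        by (auto intro!: derivative_eq_intros)
      from has_derivative_compose[OF this F]
      have "((\<lambda>y. snd (F (x, y))) has_derivative (\<lambda>h. snd (D (x, y) (0, h)))) (at y within {c..d})"
        by (rule has_derivative_snd)
      moreover have eq: "(\<lambda>h. snd (D (x, y) (0, h))) = (\<lambda>h. h *\<^sub>R snd (D (x, y) (0, 1)))" (is "?l = ?r")
      proof
        fix h
        show "?l h = ?r h"
          using linear_scale[OF has_derivative_linear[OF F], of h "(0, 1)"] by simp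
      qed
      ultimately show ?thesis
        unfolding has_vector_derivative_def eq by simp
    qed
    from fundamental_theorem_of_calculus[OF ab(2) this]
    have "((\<lambda>y. snd (D (x, y) (0, 1))) has_integral snd (F (x, d)) - snd (F (x, c))) {c..d}"
      by blast
    moreover have "F (x, d) = 0" "F (x, c) = 0"
      using bdry[of "(x, d)"] bdry[of "(x, c)"] x ab by auto
    ultimately show ?thesis
      by (simp add: integral_unique)
  qed
  have "integral ?B (\<lambda>p. fst (D p (1, 0)))
      = integral (cbox a b) (\<lambda>x. integral (cbox c d) (\<lambda>y. fst (D (x, y) (1, 0))))"
    by (rule integral_prod_continuous[OF c1])
  also have "\<dots> = integral (cbox c d) (\<lambda>y. integral (cbox a b) (\<lambda>x. fst (D (x, y) (1, 0))))"
    using c1 by (intro integral_swap_continuous) (simp add: case_prod_beta')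
  also have "\<dots> = integral (cbox c d) (\<lambda>y. 0)"
    by (rule integral_cong) (rule 1)
  finally have i1: "integral ?B (\<lambda>p. fst (D p (1, 0))) = 0"
    by simp
  have "integral ?B (\<lambda>p. snd (D p (0, 1)))
      = integral (cbox a b) (\<lambda>x. integral (cbox c d) (\<lambda>y. snd (D (x, y) (0, 1))))"
    by (rule integral_prod_continuous[OF c2])
  also have "\<dots> = integral (cbox a b) (\<lambda>x. 0)"
    by (rule integral_cong) (rule 2)
  finally have i2: "integral ?B (\<lambda>p. snd (D p (0, 1))) = 0"
    by simp
  show ?thesis
    using i1 i2 integral_add[OF integrable_continuous[OF c1] integrable_continuous[OF c2]] by simp
qed

section \<open>Continuously differentiable cutoff profiles in one variable\<close>

lemma has_real_derivative_max0_square: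
  "((\<lambda>s::real. (max 0 s)\<^sup>2) has_real_derivative 2 * max 0 s) (at s)"
proof -
  consider "s < 0" | "s = 0" | "s > 0" by linarith
  then show ?thesis
  proof cases
    case 1
    have "((\<lambda>s::real. 0) has_real_derivative 0) (at s)"
      by simp
    then show ?thesis
      using has_field_derivative_transform_within_open[of "\<lambda>s. 0" 0 s "{..<0}" "\<lambda>s. (max 0 s)\<^sup>2"] 1
      by simp
  next
    case 2
    have "((\<lambda>h. ((max 0 h)\<^sup>2) / h) \<longlongrightarrow> 0) (at (0::real))"
    proof (rule Lim_null_comparison)
      show "\<forall>\<^sub>F h in at 0. norm ((max 0 h)\<^sup>2 / h) \<le> \<bar>h::real\<bar>"
        by (rule always_eventually) (auto simp: max_def power2_eq_square)
      show "((\<lambda>h. \<bar>h\<bar>) \<longlongrightarrow> 0) (at (0::real))"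
        by (auto intro!: tendsto_eq_intros)
    qed
    then show ?thesis
      using 2 by (simp add: DERIV_def)
  next
    case 3
    have "((\<lambda>s::real. s\<^sup>2) has_real_derivative 2 * s) (at s)"
      by (auto intro!: derivative_eq_intros)
    then show ?thesis
      using has_field_derivative_transform_within_open[of "\<lambda>s. s\<^sup>2" "2 * s" s "{0<..}" "\<lambda>s. (max 0 s)\<^sup>2"] 3
      by simp
  qed
qed

lemma DERIV_max0_square_compose [derivative_intros]:
  assumes "(g has_real_derivative g') (at s within A)"
  shows "((\<lambda>s. (max 0 (g s))\<^sup>2) has_real_derivative 2 * max 0 (g s) * g') (at s within A)"
  using DERIV_chain2[OF has_real_derivative_max0_square assms] .

text \<open>A step from 0 to 1 over the unit interval; its derivative is the tent of height 2
  there.\<close>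

definition ramp :: "real \<Rightarrow> real" where
  "ramp s = 2 * (max 0 s)\<^sup>2 - 4 * (max 0 (s - 1/2))\<^sup>2 + 2 * (max 0 (s - 1))\<^sup>2"

definition dramp :: "real \<Rightarrow> real" where
  "dramp s = 4 * max 0 s - 8 * max 0 (s - 1/2) + 4 * max 0 (s - 1)"

lemma has_real_derivative_ramp: "(ramp has_real_derivative dramp s) (at s)"
  unfolding ramp_def dramp_def by (auto intro!: derivative_eq_intros)

lemma continuous_on_dramp [continuous_intros]:
  "continuous_on S g \<Longrightarrow> continuous_on S (\<lambda>x. dramp (g x))"
  unfolding dramp_def by (intro continuous_intros)

lemma dramp_bounds: "0 \<le> dramp s" "dramp s \<le> 2"
  by (auto simp: dramp_def max_def)

lemma ramp_lower: "s \<le> 0 \<Longrightarrow> ramp s = 0 \<and> dramp s = 0"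
  by (auto simp: ramp_def dramp_def max_def)

lemma ramp_upper: "1 \<le> s \<Longrightarrow> ramp s = 1 \<and> dramp s = 0"
  by (auto simp: ramp_def dramp_def max_def power2_eq_square algebra_simps)

lemma ramp_bounds: "0 \<le> ramp s" "ramp s \<le> 1"
proof -
  have mono: "ramp x \<le> ramp y" if "x \<le> y" for x y
    by (rule DERIV_nonneg_imp_nondecreasing[OF that]) (use has_real_derivative_ramp dramp_bounds in blast)
  show "0 \<le> ramp s"
    using mono[of "min 0 s" s] ramp_lower[of "min 0 s"] by simp
  show "ramp s \<le> 1"
    using mono[of s "max 1 s"] ramp_upper[of "max 1 s"] by simp
qed

text \<open>This is \<open>\<chi>\<close> of the overview. The square makes it differentiable at
  \<open>d\<close>, the quotient bounds it by 1, and being 0 up to \<open>d\<close> it kills all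
  fields near the edges of the strip.\<close>

definition sat :: "real \<Rightarrow> real \<Rightarrow> real" where
  "sat d s = (max 0 (s - d))\<^sup>2 / (1 + (max 0 (s - d))\<^sup>2)"

definition dsat :: "real \<Rightarrow> real \<Rightarrow> real" where
  "dsat d s = 2 * max 0 (s - d) / (1 + (max 0 (s - d))\<^sup>2)\<^sup>2"

lemma one_plus_square_pos: "0 < 1 + (x::real)\<^sup>2"
  by (simp add: add_pos_nonneg)

lemma has_real_derivative_sat: "(sat d has_real_derivative dsat d s) (at s)"
proof -
  define z where "z = (max 0 (s - d))\<^sup>2"
  have z: "1 + z \<noteq> 0"
    using one_plus_square_pos[of "max 0 (s - d)"] by (simp add: z_def)
  have 1: "((\<lambda>s. (max 0 (s - d))\<^sup>2) has_real_derivative 2 * max 0 (s - d)) (at s)"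
    by (auto intro!: derivative_eq_intros)
  have 2: "((\<lambda>z. z / (1 + z)) has_real_derivative 1 / (1 + z)\<^sup>2) (at ((max 0 (s - d))\<^sup>2))"
    using z by (auto intro!: derivative_eq_intros simp: power2_eq_square z_def)
  show ?thesis
    using DERIV_chain2[OF 2 1] by (simp add: sat_def[abs_def] dsat_def z_def)
qed

lemma continuous_on_dsat [continuous_intros]:
  assumes "continuous_on S g"
  shows "continuous_on S (\<lambda>x. dsat d (g x))"
proof -
  have "(1 + (max 0 (g s - d))\<^sup>2)\<^sup>2 \<noteq> 0" for s
    using one_plus_square_pos[of "max 0 (g s - d)"] by simp
  then show ?thesis
    unfolding dsat_def by (intro continuous_intros assms ballI)
qed

lemma continuous_on_sat [continuous_intros]:
  assumes "continuous_on S g"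
  shows "continuous_on S (\<lambda>x. sat d (g x))"
proof -
  have "1 + (max 0 (g s - d))\<^sup>2 \<noteq> 0" for s
    using one_plus_square_pos[of "max 0 (g s - d)"] by linarith
  then show ?thesis
    unfolding sat_def by (intro continuous_intros assms ballI)
qed

lemma sat_bounds: "0 \<le> sat d s" "sat d s \<le> 1"
  using one_plus_square_pos[of "max 0 (s - d)"] by (simp_all add: sat_def)

lemma dsat_nonneg: "0 \<le> dsat d s"
  by (simp add: dsat_def)

lemma sat_lower: "s \<le> d \<Longrightarrow> sat d s = 0 \<and> dsat d s = 0"
  by (simp add: sat_def dsat_def)

lemma sat_pos: "d < s \<Longrightarrow> 0 < sat d s \<and> 0 < dsat d s"
  using one_plus_square_pos[of "max 0 (s - d)"] by (simp add: sat_def dsat_def)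

text \<open>With \<open>m\<close> the positive part of \<open>s - d\<close>, \<open>sat\<close> is
  \<open>m * (1 + m^2) / 2\<close> times \<open>dsat\<close>. So where the difference is bounded,
  the weight in the flux is controlled by the weight in the energy.\<close>

lemma sat_le_dsat:
  assumes "0 \<le> d" "0 \<le> C" "s \<le> C"
  shows "sat d s \<le> C * (1 + C\<^sup>2) / 2 * dsat d s"
proof -
  define m where "m = max 0 (s - d)"
  have m: "0 \<le> m" "m \<le> C"
    using assms by (auto simp: m_def)
  have "m\<^sup>2 / q = m * q / 2 * (2 * m / q\<^sup>2)" if "0 < q" for q
    using that by (simp add: power2_eq_square)
  from this[OF one_plus_square_pos] have "sat d s = m * (1 + m\<^sup>2) / 2 * dsat d s"
    by (simp only: sat_def dsat_def m_def)
  also have "\<dots> \<le> C * (1 + C\<^sup>2) / 2 * dsat d s"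
    using m by (intro mult_right_mono divide_right_mono mult_mono add_mono power_mono dsat_nonneg) auto
  finally show ?thesis .
qed

section \<open>The energy estimate\<close>

locale two_graphs =
  fixes h d :: real and \<Omega> :: "(real \<times> real) set"
    and u v :: "real \<times> real \<Rightarrow> real"
    and Gu Gv :: "real \<times> real \<Rightarrow> real \<times> real"
    and Bu Bv :: "real \<times> real \<Rightarrow> real \<times> real \<Rightarrow> real \<times> real"
  assumes h: "0 < h" and d: "0 < d"
    and \<Omega>: "\<Omega> = UNIV \<times> {- h<..<h}"
    and cu: "continuous_on (closure \<Omega>) u" and cv: "continuous_on (closure \<Omega>) v"
    and bd: "\<And>p. p \<in> frontier \<Omega> \<Longrightarrow> u p = v p"
    and gu: "graph_on \<Omega> u Gu Bu" and gv: "graph_on \<Omega> v Gv Bv"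
    and dv: "\<And>p. p \<in> \<Omega> \<Longrightarrow> graph_div (Gu p) (Bu p) = graph_div (Gv p) (Bv p)"
begin

section \<open>The difference of the two solutions and its energy density\<close>

definition diff :: "real \<times> real \<Rightarrow> real" where "diff p = u p - v p"

definition X :: "real \<times> real \<Rightarrow> real \<times> real" where "X p = nmap (Gu p) - nmap (Gv p)"

definition DX :: "real \<times> real \<Rightarrow> real \<times> real \<Rightarrow> real \<times> real" where
  "DX p e = dnmap (Gu p) (Bu p e) - dnmap (Gv p) (Bv p e)"

definition ext :: "(real \<times> real \<Rightarrow> 'b::real_normed_vector) \<Rightarrow> real \<times> real \<Rightarrow> 'b" where
  "ext g p = (if p \<in> \<Omega> then g p else 0)"

definition bx :: "real \<Rightarrow> (real \<times> real) set" where "bx M = cbox (- M, - h) (M, h)"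

definition en :: "real \<times> real \<Rightarrow> real" where
  "en p = dsat d (diff p) * ((Gu p - Gv p) \<bullet> X p)"

lemma open_dom: "open \<Omega>"
  unfolding \<Omega> by (simp add: open_Times)

lemma mem_dom: "p \<in> \<Omega> \<longleftrightarrow> \<bar>snd p\<bar> < h"
  unfolding \<Omega> by (cases p) auto

lemma closure_dom: "closure \<Omega> = UNIV \<times> {- h..h}"
  unfolding \<Omega> using h by (simp add: closure_Times)

lemma frontier_dom: "frontier \<Omega> = UNIV \<times> {- h, h}"
proof -
  have "p \<in> frontier \<Omega> \<longleftrightarrow> p \<in> UNIV \<times> {- h, h}" for p
    unfolding frontier_def interior_open[OF open_dom] closure_dom Diff_iff mem_dom mem_Times_iff
    using h by (auto simp: abs_if)
  then show ?thesis
    by blast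
qed

lemma mem_bx: "p \<in> bx M \<longleftrightarrow> \<bar>fst p\<bar> \<le> M \<and> \<bar>snd p\<bar> \<le> h"
  unfolding bx_def by (cases p) (auto simp: abs_le_iff)

lemma cdiff: "continuous_on (closure \<Omega>) diff"
  unfolding diff_def[abs_def] by (intro continuous_intros cu cv)

lemma diff_frontier: "p \<in> frontier \<Omega> \<Longrightarrow> diff p = 0"
  by (simp add: diff_def bd)

lemma contG: "continuous_on \<Omega> Gu" "continuous_on \<Omega> Gv"
  using graph_on_continuous gu gv by blast+

lemma contB: "continuous_on \<Omega> (\<lambda>p. Bu p e)" "continuous_on \<Omega> (\<lambda>p. Bv p e)"
  using gu gv unfolding graph_on_def by blast+

lemma cdiff_dom: "continuous_on \<Omega> diff"
  using cdiff closure_subset continuous_on_subset by blast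

lemma contX: "continuous_on \<Omega> X"
  unfolding X_def[abs_def] by (intro continuous_intros contG)

lemma contDX: "continuous_on \<Omega> (\<lambda>p. DX p e)"
  unfolding DX_def by (intro continuous_intros contG contB)

lemma DX: "p \<in> \<Omega> \<Longrightarrow> (X has_derivative DX p) (at p)"
  unfolding X_def[abs_def] DX_def[abs_def] using gu gv unfolding graph_on_def
  by (intro has_derivative_diff has_derivative_nmap) auto

lemma trace_DX: "p \<in> \<Omega> \<Longrightarrow> fst (DX p (1, 0)) + snd (DX p (0, 1)) = 0"
  using dv[of p] unfolding graph_div_def sum_Basis_real_prod by (simp add: DX_def inner_prod_def)

lemma gdiff: "p \<in> \<Omega> \<Longrightarrow> GDERIV diff p :> Gu p - Gv p"
  unfolding diff_def[abs_def] using gu gv unfolding graph_on_def by (intro GDERIV_diff) auto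

lemma en_nonneg: "0 \<le> en p"
  unfolding en_def X_def using nmap_monotone[of "Gu p" "Gv p"]
  by (intro mult_nonneg_nonneg dsat_nonneg) (meson order_trans zero_le_power2)

lemma normX: "norm (X p) \<le> 2"
  unfolding X_def using norm_triangle_ineq4[of "nmap (Gu p)" "nmap (Gv p)"] norm_nmap_le[of "Gu p"] norm_nmap_le[of "Gv p"]
  by linarith

text \<open>
  The difference is small near the boundary of the strip, so that fields supported where it exceeds
  \<open>d\<close> extend by zero.
\<close>

lemma open_low: "open (- {p \<in> closure \<Omega>. d \<le> diff p})"
proof -
  have "{p \<in> closure \<Omega>. d \<le> diff p} = closure \<Omega> \<inter> diff -` {d..}"
    by auto
  then have "closed {p \<in> closure \<Omega>. d \<le> diff p}"
    using continuous_closed_preimage[OF cdiff closed_closure closed_atLeast] by metis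
  then show ?thesis
    by (rule open_Compl)
qed

lemma low_cover: "\<Omega> \<union> - {p \<in> closure \<Omega>. d \<le> diff p} = UNIV"
proof -
  have "p \<in> \<Omega>" if "p \<in> closure \<Omega>" "d \<le> diff p" for p
  proof (rule ccontr)
    assume "p \<notin> \<Omega>"
    then have "p \<in> frontier \<Omega>"
      using that by (simp add: frontier_def interior_open[OF open_dom])
    then show False
      using that d diff_frontier by fastforce
  qed
  then show ?thesis
    by auto
qed

lemma ext_low:
  assumes "\<And>p. p \<in> \<Omega> \<Longrightarrow> diff p \<le> d \<Longrightarrow> g p = 0"
    and "p \<in> - {p \<in> closure \<Omega>. d \<le> diff p}"
  shows "ext g p = 0"
proof (cases "p \<in> \<Omega>")
  case True
  then have "diff p \<le> d"
    using assms(2) closure_subset[of \<Omega>] by auto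
  then show ?thesis
    using assms(1) True by (simp add: ext_def)
qed (simp add: ext_def)

text \<open>Glued from two open sets that cover the plane: the strip, and the complement of the
  closed set where the difference reaches \<open>d\<close>, on which the extension is 0.\<close>

lemma continuous_on_ext:
  assumes "continuous_on \<Omega> g" and "\<And>p. p \<in> \<Omega> \<Longrightarrow> diff p \<le> d \<Longrightarrow> g p = 0"
  shows "continuous_on S (ext g)"
proof -
  have "continuous_on \<Omega> (ext g)"
    using assms(1) by (rule continuous_on_eq) (simp add: ext_def)
  moreover have "continuous_on (- {p \<in> closure \<Omega>. d \<le> diff p}) (ext g)"
    by (rule continuous_on_eq[of _ "\<lambda>_. 0"]) (use ext_low[OF assms(2)] in \<open>auto\<close>)
  ultimately have "continuous_on UNIV (ext g)"
    using continuous_on_open_Un[OF open_dom open_low] low_cover by metis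
  then show ?thesis
    using continuous_on_subset by blast
qed

lemma has_derivative_ext:
  assumes "\<And>p. p \<in> \<Omega> \<Longrightarrow> diff p \<le> d \<Longrightarrow> g p = 0"
    and "\<And>p e. p \<in> \<Omega> \<Longrightarrow> diff p \<le> d \<Longrightarrow> D p e = 0"
    and "\<And>p. p \<in> \<Omega> \<Longrightarrow> (g has_derivative D p) (at p)"
  shows "(ext g has_derivative (\<lambda>e. ext (\<lambda>p. D p e) p)) (at p)"
proof (cases "p \<in> \<Omega>")
  case True
  have "(ext g has_derivative D p) (at p)"
    by (rule has_derivative_transform_within_open[OF assms(3)[OF True] open_dom True])
      (simp add: ext_def)
  then show ?thesis
    using True by (simp add: ext_def)
next
  case False
  let ?V = "- {p \<in> closure \<Omega>. d \<le> diff p}"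
  have p: "p \<in> ?V"
    using False low_cover by blast
  have "(ext g has_derivative (\<lambda>_. 0)) (at p)"
    by (rule has_derivative_transform_within_open[OF has_derivative_const[of 0] open_low p])
      (simp only: ext_low[OF assms(1)])
  then show ?thesis
    using False by (simp add: ext_def)
qed

text \<open>The divergence theorem for the field \<open>k \<chi>(\<phi>) X\<close>. The product rule
  gives the integrand plus a multiple of the divergence of \<open>X\<close>, which is 0. On the
  boundary of the box the field vanishes because of \<open>k\<close> at the two ends and because of
  the extension by zero on the edges.\<close>

lemma weak_identity:
  assumes gk: "\<And>p. p \<in> \<Omega> \<Longrightarrow> GDERIV k p :> K p" and cK: "continuous_on \<Omega> K"
    and M: "0 \<le> M" and k0: "\<And>p. p \<in> \<Omega> \<Longrightarrow> M \<le> \<bar>fst p\<bar> \<Longrightarrow> k p = 0"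
  shows "integral (bx M) (ext (\<lambda>p. k p * en p + sat d (diff p) * (K p \<bullet> X p))) = 0"
proof -
  define F where "F p = (k p * sat d (diff p)) *\<^sub>R X p" for p
  define D where "D p e = (k p * sat d (diff p)) *\<^sub>R DX p e
    + ((K p \<bullet> e) * sat d (diff p) + k p * (dsat d (diff p) * ((Gu p - Gv p) \<bullet> e))) *\<^sub>R X p" for p e
  have ck: "continuous_on \<Omega> k"
    using gk unfolding gderiv_def
    by (intro continuous_at_imp_continuous_on ballI) (auto dest!: has_derivative_continuous)
  have FD: "(F has_derivative D p) (at p)" if p: "p \<in> \<Omega>" for p
  proof -
    have 1: "(k has_derivative (\<lambda>e. e \<bullet> K p)) (at p)"
      using gk[OF p] by (simp add: gderiv_def)
    have "(diff has_derivative (\<lambda>e. e \<bullet> (Gu p - Gv p))) (at p)"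
      using gdiff[OF p] by (simp add: gderiv_def)
    from has_derivative_compose[OF this has_field_derivative_imp_has_derivative[OF has_real_derivative_sat]]
    have 2: "((\<lambda>p. sat d (diff p)) has_derivative (\<lambda>e. dsat d (diff p) * (e \<bullet> (Gu p - Gv p)))) (at p)" .
    have "(F has_derivative (\<lambda>e. (k p * sat d (diff p)) *\<^sub>R DX p e
      + (k p * (dsat d (diff p) * (e \<bullet> (Gu p - Gv p))) + (e \<bullet> K p) * sat d (diff p)) *\<^sub>R X p)) (at p)"
      unfolding F_def[abs_def] by (rule has_derivative_scaleR[OF has_derivative_mult[OF 1 2] DX[OF p]])
    then show ?thesis
      unfolding D_def[abs_def] by (simp add: inner_commute add.commute)
  qed
  have cD: "continuous_on \<Omega> (\<lambda>p. D p e)" for e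
    unfolding D_def by (intro continuous_intros contDX contX contG cdiff_dom cK ck)
  have low: "F p = 0 \<and> D p e = 0" if "p \<in> \<Omega>" "diff p \<le> d" for p e
    using sat_lower[OF that(2)] by (simp add: F_def D_def)
  have "integral (bx M) (\<lambda>p. fst (ext (\<lambda>p. D p (1, 0)) p) + snd (ext (\<lambda>p. D p (0, 1)) p)) = 0"
    unfolding bx_def
  proof (rule integral_divergence_zero)
    show "(ext F has_derivative (\<lambda>e. ext (\<lambda>p. D p e) p)) (at p)" for p
      by (rule has_derivative_ext) (use FD low in auto)
    show "continuous_on (cbox (- M, - h) (M, h)) (ext (\<lambda>p. D p e))" for e
      by (rule continuous_on_ext[OF cD]) (use low in auto)
    show "ext F p = 0" if "fst p = - M \<or> fst p = M \<or> snd p = - h \<or> snd p = h" for p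
    proof (cases "p \<in> \<Omega>")
      case True
      then have "M \<le> \<bar>fst p\<bar>"
        using that h M by (auto simp: mem_dom)
      then show ?thesis
        using True k0 by (simp add: ext_def F_def)
    qed (simp add: ext_def)
  qed (use M h in auto)
  moreover have "fst (ext (\<lambda>p. D p (1, 0)) p) + snd (ext (\<lambda>p. D p (0, 1)) p)
      = ext (\<lambda>p. k p * en p + sat d (diff p) * (K p \<bullet> X p)) p" for p
  proof (cases "p \<in> \<Omega>")
    case True
    have "fst (D p (1, 0)) + snd (D p (0, 1))
      = (k p * sat d (diff p)) * (fst (DX p (1, 0)) + snd (DX p (0, 1)))
        + k p * en p + sat d (diff p) * (K p \<bullet> X p)"
      by (simp add: D_def en_def inner_prod_def algebra_simps)
    then show ?thesis
      using True trace_DX by (simp add: ext_def)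
  qed (simp add: ext_def)
  ultimately show ?thesis
    by simp
qed

lemma cont_en: "continuous_on \<Omega> en"
  unfolding en_def[abs_def] by (intro continuous_intros contX contG cdiff_dom)

lemma en_low: "diff p \<le> d \<Longrightarrow> en p = 0"
  by (simp add: en_def sat_lower)

lemma cont_ext_en: "continuous_on S (ext en)"
  by (rule continuous_on_ext[OF cont_en]) (simp add: en_low)

lemma ext_en_nonneg: "0 \<le> ext en p"
  by (simp add: ext_def en_nonneg)

text \<open>
  A cutoff at the end \<open>s x \<rightarrow> \<infinity>\<close> of the strip, together with a bound \<open>e\<close> on the flux of the
  difference field that it costs.
\<close>

definition cutoff :: "real \<Rightarrow> real \<Rightarrow> real \<Rightarrow> real \<Rightarrow> (real \<times> real \<Rightarrow> real) \<Rightarrow> (real \<times> real \<Rightarrow> real \<times> real) \<Rightarrow> bool"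
  where "cutoff s N M e k K \<longleftrightarrow> (\<forall>p\<in>\<Omega>. GDERIV k p :> K p) \<and> continuous_on \<Omega> K \<and>
    (\<forall>p\<in>\<Omega>. 0 \<le> k p \<and> k p \<le> 1 \<and> (s * fst p \<le> N \<longrightarrow> k p = 1 \<and> K p = 0) \<and> (M \<le> s * fst p \<longrightarrow> k p = 0)) \<and>
    (\<forall>M'\<ge>M. - integral (bx M') (ext (\<lambda>p. sat d (diff p) * (K p \<bullet> X p))) \<le> e)"

lemma cont_flux:
  assumes "continuous_on \<Omega> K"
  shows "continuous_on S (ext (\<lambda>p. sat d (diff p) * (K p \<bullet> X p)))"
  by (rule continuous_on_ext) (auto intro!: continuous_intros assms cdiff_dom contX simp: sat_lower)

text \<open>The test function is the product of the two cutoffs. As \<open>N \<ge> 0\<close>, at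
  each point one factor is 1 with zero gradient, so the gradients add and the costs of the two ends
  separate.\<close>

lemma energy_le:
  assumes c1: "cutoff 1 N M1 e1 k1 K1" and c2: "cutoff (- 1) N M2 e2 k2 K2" and N: "0 \<le> N"
  shows "integral (bx N) (ext en) \<le> e1 + e2"
proof -
  define L where "L = max N (max M1 M2)"
  have L: "N \<le> L" "M1 \<le> L" "M2 \<le> L" "0 \<le> L"
    using N by (auto simp: L_def)
  define k where "k p = k1 p * k2 p" for p
  have k1: "GDERIV k1 p :> K1 p" "0 \<le> k1 p" "k1 p \<le> 1" "fst p \<le> N \<longrightarrow> k1 p = 1 \<and> K1 p = 0"
    "M1 \<le> fst p \<longrightarrow> k1 p = 0" if "p \<in> \<Omega>" for p
    using c1 that unfolding cutoff_def by auto
  have k2: "GDERIV k2 p :> K2 p" "0 \<le> k2 p" "k2 p \<le> 1" "- fst p \<le> N \<longrightarrow> k2 p = 1 \<and> K2 p = 0"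
    "M2 \<le> - fst p \<longrightarrow> k2 p = 0" if "p \<in> \<Omega>" for p
    using c2 that unfolding cutoff_def by auto
  have cK: "continuous_on \<Omega> K1" "continuous_on \<Omega> K2"
    using c1 c2 unfolding cutoff_def by auto
  have gk: "GDERIV k p :> K1 p + K2 p" if p: "p \<in> \<Omega>" for p
  proof -
    have "GDERIV k p :> k1 p *\<^sub>R K2 p + k2 p *\<^sub>R K1 p"
      unfolding k_def[abs_def] by (intro GDERIV_mult k1(1) k2(1) p)
    moreover have "k1 p *\<^sub>R K2 p + k2 p *\<^sub>R K1 p = K1 p + K2 p"
      using k1(4)[OF p] k2(4)[OF p] N by (cases "0 \<le> fst p") (auto simp: add.commute)
    ultimately show ?thesis
      by simp
  qed
  have ck: "continuous_on \<Omega> k"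
    using gk unfolding gderiv_def
    by (intro continuous_at_imp_continuous_on ballI) (auto dest!: has_derivative_continuous)
  have k0: "k p = 0" if "p \<in> \<Omega>" "L \<le> \<bar>fst p\<bar>" for p
    using k1(5)[OF that(1)] k2(5)[OF that(1)] that(2) L by (auto simp: k_def abs_if split: if_splits)
  have ci: "continuous_on (bx L) (ext (\<lambda>p. k p * en p))"
    by (rule continuous_on_ext) (auto intro!: continuous_intros ck cont_en simp: en_low)
  let ?f1 = "ext (\<lambda>p. sat d (diff p) * (K1 p \<bullet> X p))"
  let ?f2 = "ext (\<lambda>p. sat d (diff p) * (K2 p \<bullet> X p))"
  have i: "ext (\<lambda>p. k p * en p) integrable_on bx L" "?f1 integrable_on bx L" "?f2 integrable_on bx L"
    using ci cont_flux[OF cK(1), of "bx L"] cont_flux[OF cK(2), of "bx L"] unfolding bx_def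
    by (auto intro: integrable_continuous)
  have "0 = integral (bx L) (ext (\<lambda>p. k p * en p + sat d (diff p) * ((K1 p + K2 p) \<bullet> X p)))"
    by (rule weak_identity[symmetric]) (use gk cK k0 L in \<open>auto intro!: continuous_intros\<close>)
  also have "\<dots> = integral (bx L) (\<lambda>p. ext (\<lambda>p. k p * en p) p + (?f1 p + ?f2 p))"
    by (rule integral_cong) (simp add: ext_def inner_add_left algebra_simps)
  also have "\<dots> = integral (bx L) (ext (\<lambda>p. k p * en p)) + (integral (bx L) ?f1 + integral (bx L) ?f2)"
    using i by (simp add: integral_add integrable_add)
  finally have "integral (bx L) (ext (\<lambda>p. k p * en p)) = - integral (bx L) ?f1 - integral (bx L) ?f2"
    by simp
  also have "\<dots> \<le> e1 + e2"
    using c1 c2 L unfolding cutoff_def by (smt (verit))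
  finally have A: "integral (bx L) (ext (\<lambda>p. k p * en p)) \<le> e1 + e2" .
  have "integral (bx N) (ext en) = integral (bx N) (ext (\<lambda>p. k p * en p))"
  proof (rule integral_cong)
    fix p assume "p \<in> bx N"
    then show "ext en p = ext (\<lambda>p. k p * en p) p"
      using k1(4)[of p] k2(4)[of p] by (auto simp: ext_def k_def mem_bx)
  qed
  also have "\<dots> \<le> integral (bx L) (ext (\<lambda>p. k p * en p))"
  proof (rule integral_subset_le)
    show "bx N \<subseteq> bx L"
      using L by (auto simp: mem_bx)
    then show "ext (\<lambda>p. k p * en p) integrable_on bx N"
      using continuous_on_subset[OF ci] unfolding bx_def by (blast intro: integrable_continuous)
    show "\<forall>p\<in>bx L. 0 \<le> ext (\<lambda>p. k p * en p) p"
      using k1(2) k2(2) en_nonneg by (auto simp: ext_def k_def)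
  qed (rule i)
  finally show ?thesis
    using A by simp
qed

section \<open>Slabs across the strip and cutoffs depending on \<open>x\<close> only\<close>

definition slab :: "real \<Rightarrow> real \<Rightarrow> real \<Rightarrow> (real \<times> real) set" where
  "slab s a b = (if s = 1 then cbox (a, - h) (b, h) else cbox (- b, - h) (- a, h))"

lemma mem_slab: "s = 1 \<or> s = - 1 \<Longrightarrow> p \<in> slab s a b \<longleftrightarrow> a \<le> s * fst p \<and> s * fst p \<le> b \<and> \<bar>snd p\<bar> \<le> h"
  unfolding slab_def by (cases p) (auto simp: abs_le_iff)

lemma integrable_slab: "continuous_on (slab s a b) g \<Longrightarrow> g integrable_on slab s a b"
  for g :: "real \<times> real \<Rightarrow> real"
  unfolding slab_def by (auto intro: integrable_continuous split: if_splits)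

lemma integrable_bx: "continuous_on (bx M) g \<Longrightarrow> g integrable_on bx M"
  for g :: "real \<times> real \<Rightarrow> real"
  unfolding bx_def by (rule integrable_continuous)

lemma integral_slab_const: "a \<le> b \<Longrightarrow> integral (slab s a b) (\<lambda>_. B) = B * ((b - a) * (2 * h))" for B :: real
  using h by (auto simp: slab_def content_Pair)

text \<open>The two terms are paid differently: \<open>B\<close> by the area of the slab,
  \<open>C\<close> by the energy in it, which becomes small far out.\<close>

lemma flux_bound:
  assumes s: "s = 1 \<or> s = - 1" and ab: "a \<le> b" and M: "\<bar>a\<bar> \<le> M" "\<bar>b\<bar> \<le> M"
    and g: "continuous_on \<Omega> g" "\<And>p. p \<in> \<Omega> \<Longrightarrow> diff p \<le> d \<Longrightarrow> g p = (0::real)"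
    and bound: "\<And>p. p \<in> \<Omega> \<Longrightarrow> a \<le> s * fst p \<Longrightarrow> s * fst p \<le> b \<Longrightarrow> g p \<le> B + C * en p"
    and zero: "\<And>p. p \<in> \<Omega> \<Longrightarrow> s * fst p < a \<or> b < s * fst p \<Longrightarrow> g p = 0"
    and B: "0 \<le> B"
  shows "integral (bx M) (ext g) \<le> B * ((b - a) * (2 * h)) + C * integral (slab s a b) (ext en)"
proof -
  let ?Q = "slab s a b"
  have cg: "continuous_on ?Q (ext g)"
    by (rule continuous_on_ext[OF g])
  have "(ext g has_integral integral ?Q (ext g)) (bx M)"
  proof (rule has_integral_on_superset)
    show "(ext g has_integral integral ?Q (ext g)) ?Q"
      using integrable_slab[OF cg] by (rule integrable_integral)
    show "ext g p = 0" if "p \<notin> ?Q" for p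
      using that zero[of p] unfolding mem_slab[OF s] by (auto simp: ext_def mem_dom)
    show "?Q \<subseteq> bx M"
      using s M by (auto simp: mem_slab mem_bx)
  qed
  then have "integral (bx M) (ext g) = integral ?Q (ext g)"
    by (rule integral_unique)
  also have "\<dots> \<le> integral ?Q (\<lambda>p. B + C * ext en p)"
  proof (rule integral_le)
    show "ext g integrable_on ?Q" "(\<lambda>p. B + C * ext en p) integrable_on ?Q"
      by (intro integrable_slab cg continuous_intros cont_ext_en)+
    show "ext g p \<le> B + C * ext en p" if "p \<in> ?Q" for p
      using that bound[of p] B unfolding mem_slab[OF s] by (auto simp: ext_def)
  qed
  also have "\<dots> = integral ?Q (\<lambda>_. B) + C * integral ?Q (ext en)"
    by (subst integral_add) (auto intro!: integrable_slab continuous_intros cont_ext_en)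
  finally show ?thesis
    by (simp add: integral_slab_const[OF ab])
qed

text \<open>The factor \<open>2 / (b - a)\<close> bounds the slope of \<open>ramp\<close> rescaled
  to the slab; the product with the field is estimated by Cauchy-Schwarz.\<close>

lemma xcut:
  assumes s: "s = 1 \<or> s = - 1" and ab: "a < b" and N: "N \<le> a" and a: "0 \<le> a"
    and bound: "\<And>p. p \<in> \<Omega> \<Longrightarrow> a \<le> s * fst p \<Longrightarrow> s * fst p \<le> b \<Longrightarrow>
      2 / (b - a) * (sat d (diff p) * norm (X p)) \<le> B + C * en p"
    and B: "0 \<le> B" and e: "B * ((b - a) * (2 * h)) + C * integral (slab s a b) (ext en) \<le> e"
  shows "\<exists>k K. cutoff s N b e k K"
proof -
  define k where "k p = ramp ((b - s * fst p) / (b - a))" for p :: "real \<times> real"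
  define K where "K p = (- s * dramp ((b - s * fst p) / (b - a)) / (b - a), 0::real)" for p :: "real \<times> real"
  have gk: "GDERIV k p :> K p" for p
  proof -
    have "((\<lambda>p. (b - s * fst p) / (b - a)) has_derivative (\<lambda>e. - s * fst e / (b - a))) (at p)"
      using ab by (auto intro!: derivative_eq_intros)
    from has_derivative_compose[OF this has_field_derivative_imp_has_derivative[OF has_real_derivative_ramp]]
    show ?thesis
      unfolding gderiv_def k_def[abs_def] K_def by (simp add: inner_prod_def mult_ac)
  qed
  have cK: "continuous_on \<Omega> K"
    unfolding K_def[abs_def] using ab by (intro continuous_intros) auto
  have "- integral (bx M) (ext (\<lambda>p. sat d (diff p) * (K p \<bullet> X p))) \<le> e" if M: "b \<le> M" for M
  proof -
    let ?g = "\<lambda>p. - (sat d (diff p) * (K p \<bullet> X p))"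
    have "- integral (bx M) (ext (\<lambda>p. sat d (diff p) * (K p \<bullet> X p))) = integral (bx M) (ext ?g)"
      unfolding integral_neg[symmetric] by (rule integral_cong) (simp add: ext_def)
    also have "\<dots> \<le> B * ((b - a) * (2 * h)) + C * integral (slab s a b) (ext en)"
    proof (rule flux_bound[OF s])
      show "?g p \<le> B + C * en p" if p: "p \<in> \<Omega>" "a \<le> s * fst p" "s * fst p \<le> b" for p
      proof -
        have "\<bar>K p \<bullet> X p\<bar> \<le> norm (K p) * norm (X p)"
          by (rule Cauchy_Schwarz_ineq2)
        also have "norm (K p) \<le> 2 / (b - a)"
          using s ab dramp_bounds[of "(b - s * fst p) / (b - a)"]
          by (auto simp: K_def norm_Pair abs_mult divide_right_mono)
        finally have "\<bar>K p \<bullet> X p\<bar> \<le> 2 / (b - a) * norm (X p)"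
          by (simp add: mult_right_mono)
        then have "sat d (diff p) * \<bar>K p \<bullet> X p\<bar> \<le> sat d (diff p) * (2 / (b - a) * norm (X p))"
          by (rule mult_left_mono) (rule sat_bounds)
        moreover have "?g p \<le> sat d (diff p) * \<bar>K p \<bullet> X p\<bar>"
          using sat_bounds[of d "diff p"] by (metis abs_ge_minus_self abs_mult abs_of_nonneg)
        ultimately show ?thesis
          using bound[OF p] by (simp add: mult_ac)
      qed
      show "?g p = 0" if "s * fst p < a \<or> b < s * fst p" for p
      proof -
        have "(b - s * fst p) / (b - a) \<le> 0 \<or> 1 \<le> (b - s * fst p) / (b - a)"
          using that ab by (auto simp: field_simps)
        then have "K p = 0"
          using ramp_lower ramp_upper by (auto simp: K_def zero_prod_def)
        then show ?thesis
          by simp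
      qed
      show "continuous_on \<Omega> ?g"
        by (intro continuous_intros cdiff_dom cK contX)
    qed (use ab a M B sat_lower in auto)
    finally show ?thesis
      using e by simp
  qed
  moreover have "k p = 1 \<and> K p = 0" if "s * fst p \<le> N" for p
  proof -
    have "1 \<le> (b - s * fst p) / (b - a)"
      using that ab N by (simp add: field_simps)
    then show ?thesis
      using ramp_upper by (simp add: k_def K_def zero_prod_def)
  qed
  moreover have "k p = 0" if "b \<le> s * fst p" for p
  proof -
    have "(b - s * fst p) / (b - a) \<le> 0"
      using that ab by (simp add: field_simps)
    then show ?thesis
      using ramp_lower by (simp add: k_def)
  qed
  ultimately have "cutoff s N b e k K"
    unfolding cutoff_def using gk cK ramp_bounds by (auto simp: k_def)
  then show ?thesis
    by blast
qed

lemma energy_bounded: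
  assumes "0 \<le> N"
  shows "integral (bx N) (ext en) \<le> 16 * h"
proof -
  \<comment> \<open>Slope at most 2 and \<open>normX\<close> give the density 4; a slab of length 1
    has area \<open>2 * h\<close>, hence the cost \<open>8 * h\<close> at each end.\<close>
  have "\<exists>k K. cutoff s N (N + 1) (8 * h) k K" if "s = 1 \<or> s = - 1" for s
  proof (rule xcut[OF that, where a = N and B = 4 and C = 0])
    show "2 / (N + 1 - N) * (sat d (diff p) * norm (X p)) \<le> 4 + 0 * en p" for p
      using mult_mono[OF sat_bounds(2)[of d "diff p"] normX[of p]] sat_bounds(1)[of d "diff p"]
      by (simp add: mult.commute)
  qed (use assms h in auto)
  then show ?thesis
    using energy_le[OF _ _ assms] by (smt (verit, best))
qed

text \<open>The energy in \<open>bx N\<close> is bounded in \<open>N\<close>, so some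
  \<open>N\<close> comes within \<open>e\<close> of its supremum. A slab beyond it is disjoint from
  \<open>bx N\<close>, and a larger box contains both.\<close>

lemma energy_tail:
  assumes e: "0 < e"
  obtains N where "0 \<le> N"
    "\<And>s a b. s = 1 \<or> s = - 1 \<Longrightarrow> N < a \<Longrightarrow> a \<le> b \<Longrightarrow> integral (slab s a b) (ext en) \<le> e"
proof -
  let ?E = "\<lambda>N. integral (bx N) (ext en)"
  have bdd: "bdd_above (?E ` {0..})"
    using energy_bounded by (intro bdd_aboveI[of _ "16 * h"]) auto
  have "Sup (?E ` {0..}) - e < Sup (?E ` {0..})"
    using e by simp
  then obtain N where N: "0 \<le> N" "Sup (?E ` {0..}) - e < ?E N"
    by (subst (asm) less_cSup_iff[OF _ bdd]) auto
  have "integral (slab s a b) (ext en) \<le> e" if s: "s = 1 \<or> s = - 1" and ab: "N < a" "a \<le> b" for s a b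
  proof -
    have "((ext en) has_integral (?E N + integral (slab s a b) (ext en))) (bx N \<union> slab s a b)"
    proof (rule has_integral_Un)
      show "(ext en has_integral ?E N) (bx N)" "(ext en has_integral integral (slab s a b) (ext en)) (slab s a b)"
        by (intro integrable_integral integrable_bx integrable_slab cont_ext_en)+
      have "bx N \<inter> slab s a b = {}"
        using s ab by (auto simp: mem_bx mem_slab)
      then show "negligible (bx N \<inter> slab s a b)"
        by simp
    qed
    moreover have "(ext en has_integral ?E b) (bx b)"
      by (intro integrable_integral integrable_bx cont_ext_en)
    moreover have "bx N \<union> slab s a b \<subseteq> bx b"
      using s ab N(1) by (auto simp: mem_bx mem_slab)
    ultimately have "?E N + integral (slab s a b) (ext en) \<le> ?E b"
      using has_integral_subset_le ext_en_nonneg by blast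
    moreover have "?E b \<le> Sup (?E ` {0..})"
      using N(1) ab by (intro cSup_upper bdd) auto
    ultimately show ?thesis
      using N(2) by simp
  qed
  then show thesis
    using that N(1) by blast
qed

text \<open>
  If the difference is bounded on slabs going to infinity, the flux through them is dominated by
  the square root of the energy they contain, which tends to 0 as the total energy is finite.
\<close>

lemma cutoff_bounded_slabs:
  assumes s: "s = 1 \<or> s = - 1" and \<tau>: "0 < \<tau>" and e: "0 < e" and N: "0 \<le> N" and C: "0 \<le> C"
    and slabs: "\<And>M. \<exists>a. M \<le> s * a \<and> (\<forall>p\<in>\<Omega>. \<bar>fst p - a\<bar> \<le> \<tau> \<longrightarrow> diff p \<le> C)"
  shows "\<exists>M k K. cutoff s N M e k K"
proof -
  \<comment> \<open>\<open>k\<close> is the factor of \<open>sat_le_dsat\<close>. The slab has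
    length \<open>2 * \<tau>\<close>, so \<open>\<alpha>\<close> makes the area term equal to
    \<open>e / 2\<close>, and \<open>e'\<close> keeps the energy term at most \<open>e / 2\<close>;
    the denominator has \<open>k + 1\<close> because \<open>k = 0\<close> if
    \<open>C = 0\<close>.\<close>
  define k where "k = C * (1 + C\<^sup>2) / 2"
  define \<alpha> where "\<alpha> = e / (8 * h)"
  define e' where "e' = e * (4 * \<alpha> * \<tau>) / (2 * (k + 1))"
  have k: "0 \<le> k"
    using C by (simp add: k_def)
  have \<alpha>: "0 < \<alpha>"
    using e h by (simp add: \<alpha>_def)
  have e': "0 < e'"
    using e \<alpha> \<tau> k by (simp add: e'_def)
  obtain N0 where N0: "0 \<le> N0"
    "\<And>s a b. s = 1 \<or> s = - 1 \<Longrightarrow> N0 < a \<Longrightarrow> a \<le> b \<Longrightarrow> integral (slab s a b) (ext en) \<le> e'"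
    using energy_tail[OF e'] by blast
  obtain c where c: "N0 + N + 1 + \<tau> \<le> s * c" "\<And>p. p \<in> \<Omega> \<Longrightarrow> \<bar>fst p - c\<bar> \<le> \<tau> \<Longrightarrow> diff p \<le> C"
    using slabs by blast
  let ?a = "s * c - \<tau>" and ?b = "s * c + \<tau>"
  have "\<exists>K' K. cutoff s N ?b e K' K"
  proof (rule xcut[OF s, where a = ?a and B = "\<alpha> / \<tau>" and C = "k / (4 * \<alpha>) / \<tau>"])
    show "2 / (?b - ?a) * (sat d (diff p) * norm (X p)) \<le> \<alpha> / \<tau> + k / (4 * \<alpha>) / \<tau> * en p"
      if p: "p \<in> \<Omega>" "?a \<le> s * fst p" "s * fst p \<le> ?b" for p
    proof -
      have "diff p \<le> C"
        using c(2)[of p] p s by (auto simp: abs_le_iff)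
      then have sat: "sat d (diff p) \<le> k * dsat d (diff p)"
        unfolding k_def using d C by (intro sat_le_dsat) auto
      \<comment> \<open>Young's inequality: the constant is charged to the area, the square to the
        energy through \<open>nmap_monotone\<close>.\<close>
      have "norm (X p) \<le> \<alpha> + (norm (X p))\<^sup>2 / (4 * \<alpha>)"
      proof -
        have "0 \<le> (norm (X p) - 2 * \<alpha>)\<^sup>2"
          by simp
        then show ?thesis
          using \<alpha> by (simp add: field_simps power2_eq_square)
      qed
      then have "sat d (diff p) * norm (X p) \<le> sat d (diff p) * (\<alpha> + (norm (X p))\<^sup>2 / (4 * \<alpha>))"
        by (rule mult_left_mono) (rule sat_bounds)
      also have "\<dots> = sat d (diff p) * \<alpha> + sat d (diff p) * ((norm (X p))\<^sup>2 / (4 * \<alpha>))"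
        by (simp add: distrib_left)
      also have "\<dots> \<le> 1 * \<alpha> + (k * dsat d (diff p)) * ((norm (X p))\<^sup>2 / (4 * \<alpha>))"
        using sat sat_bounds[of d "diff p"] \<alpha> by (intro add_mono mult_right_mono) auto
      also have "(k * dsat d (diff p)) * ((norm (X p))\<^sup>2 / (4 * \<alpha>)) = k / (4 * \<alpha>) * (dsat d (diff p) * (norm (X p))\<^sup>2)"
        by simp
      also have "\<dots> \<le> k / (4 * \<alpha>) * en p"
        unfolding en_def using k \<alpha> nmap_monotone[of "Gu p" "Gv p"]
        by (intro mult_left_mono) (auto simp: X_def dsat_nonneg)
      finally have "sat d (diff p) * norm (X p) \<le> \<alpha> + k / (4 * \<alpha>) * en p"
        by simp
      from divide_right_mono[OF this, of \<tau>] show ?thesis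
        using \<tau> by (simp add: add_divide_distrib)
    qed
    have "integral (slab s ?a ?b) (ext en) \<le> e'"
      using N0(2)[OF s, of ?a ?b] c(1) \<tau> N by simp
    then have "k / (4 * \<alpha>) / \<tau> * integral (slab s ?a ?b) (ext en) \<le> k / (4 * \<alpha>) / \<tau> * e'"
      using k \<alpha> \<tau> by (intro mult_left_mono) auto
    also have "\<dots> = e / 2 * (k / (k + 1))"
      using \<alpha> \<tau> k by (simp add: e'_def field_simps)
    also have "\<dots> \<le> e / 2 * 1"
      using k e by (intro mult_left_mono) (auto simp: field_simps)
    finally have "k / (4 * \<alpha>) / \<tau> * integral (slab s ?a ?b) (ext en) \<le> e / 2"
      by simp
    moreover have "\<alpha> / \<tau> * ((?b - ?a) * (2 * h)) = e / 2"
      using \<tau> h by (simp add: \<alpha>_def field_simps)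
    ultimately show "\<alpha> / \<tau> * ((?b - ?a) * (2 * h)) + k / (4 * \<alpha>) / \<tau> * integral (slab s ?a ?b) (ext en) \<le> e"
      by simp
  qed (use \<tau> c(1) N0 N \<alpha> in auto)
  then show ?thesis
    by blast
qed

text \<open>
  Here the cutoff is a function of \<open>g\<close>. Its gradient has a bounded product with the difference
  field, and the size \<open>C \<bar>a\<bar>\<close> of \<open>g\<close> at distance \<open>\<bar>a\<bar>\<close> makes up for the area.
\<close>

lemma cutoff_superlinear:
  fixes g :: "real \<times> real \<Rightarrow> real"
  assumes s: "s = 1 \<or> s = - 1" and \<tau>: "0 < \<tau>" and e: "0 < e" and N: "0 \<le> N"
    and gg: "\<And>p. p \<in> \<Omega> \<Longrightarrow> GDERIV g p :> G p" and cG: "continuous_on \<Omega> G"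
    and cg: "continuous_on (closure \<Omega>) g"
    and gX: "\<And>p. p \<in> \<Omega> \<Longrightarrow> G p \<bullet> X p \<le> 1"
    and slabs: "\<And>C M. \<exists>a. M \<le> s * a \<and> (\<forall>p\<in>\<Omega>. \<bar>fst p - a\<bar> \<le> \<tau> \<longrightarrow> C * \<bar>a\<bar> \<le> g p)"
  shows "\<exists>M k K. cutoff s N M e k K"
proof -
  have "compact (bx (N + 1))" "bx (N + 1) \<subseteq> closure \<Omega>"
    unfolding bx_def closure_dom by auto
  then have "bounded (g ` bx (N + 1))"
    using cg compact_continuous_image compact_imp_bounded continuous_on_subset by metis
  then obtain z1 where z1: "0 < z1" "\<And>p. p \<in> bx (N + 1) \<Longrightarrow> \<bar>g p\<bar> \<le> z1"
    unfolding bounded_pos by (metis image_eqI real_norm_def)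
  \<comment> \<open>The slope factor is at most \<open>2 / w\<close> with
    \<open>w \<ge> C * A / 2\<close>, over an area of at most \<open>2 * h * A\<close>; this
    \<open>C\<close> makes the resulting bound equal to \<open>e\<close>.\<close>
  define C where "C = 8 * h / e"
  have C: "0 < C"
    using h e by (simp add: C_def)
  obtain a where a: "N + \<tau> + 2 + 2 * z1 / C \<le> s * a"
    and ga: "\<And>p. p \<in> \<Omega> \<Longrightarrow> \<bar>fst p - a\<bar> \<le> \<tau> \<Longrightarrow> C * \<bar>a\<bar> \<le> g p"
    using slabs by blast
  define A where "A = s * a"
  have "0 < 2 * z1 / C"
    using z1(1) C by simp
  then have A: "N + \<tau> + 2 < A" "2 * z1 / C \<le> A" "0 < A"
    using a N \<tau> by (auto simp: A_def)
  have absa: "\<bar>a\<bar> = A"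
    using s A(3) by (auto simp: A_def)
  define w where "w = C * A - z1"
  have "2 * z1 \<le> C * A"
    using A(2) C by (metis mult.commute pos_divide_le_eq)
  then have w: "C * A / 2 \<le> w"
    unfolding w_def by linarith
  have w0: "0 < w"
    using w C A(3) by (smt (verit) half_gt_zero mult_pos_pos)
  \<comment> \<open>A ramp in \<open>g\<close> that is 1 at levels up to \<open>z1\<close> and 0
    from level \<open>C * A\<close> on, overridden by constants up to \<open>N\<close> and from
    \<open>A\<close> on. The override is smooth: the bound \<open>z1\<close> up to
    \<open>N + 1\<close> and the growth of \<open>g\<close> after \<open>A - \<tau>\<close> already
    give the ramp these constant values there.\<close>
  define k where "k p = (if s * fst p \<le> N then 1 else if A \<le> s * fst p then 0 else ramp ((C * A - g p) / w))" for p
  define K where "K p = (if s * fst p \<le> N \<or> A \<le> s * fst p then 0 else - (dramp ((C * A - g p) / w) / w) *\<^sub>R G p)" for p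
  define U1 where "U1 = {p \<in> \<Omega>. s * fst p < N + 1}"
  define U2 where "U2 = {p \<in> \<Omega>. A - \<tau> < s * fst p}"
  define U3 where "U3 = {p \<in> \<Omega>. N < s * fst p \<and> s * fst p < A}"
  have "U1 = \<Omega> \<inter> (\<lambda>p. s * fst p) -` {..<N + 1}" "U2 = \<Omega> \<inter> (\<lambda>p. s * fst p) -` {A - \<tau><..}"
    "U3 = \<Omega> \<inter> (\<lambda>p. s * fst p) -` {N<..<A}"
    by (auto simp: U1_def U2_def U3_def)
  then have op: "open U1" "open U2" "open U3"
    using open_dom by (simp_all add: open_Int open_vimage continuous_intros)
  have cover: "\<Omega> = U1 \<union> U2 \<union> U3"
    using A \<tau> by (auto simp: U1_def U2_def U3_def)
  have u1: "k p = 1 \<and> K p = 0" if p: "p \<in> U1" for p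
  proof (cases "s * fst p \<le> N")
    case False
    then have "p \<in> bx (N + 1)"
      using p s N unfolding U1_def by (auto simp: mem_bx mem_dom)
    then have "g p \<le> z1"
      using z1 by fastforce
    then have "1 \<le> (C * A - g p) / w"
      using w0 by (simp add: field_simps w_def)
    then show ?thesis
      using ramp_upper False p A \<tau> by (auto simp: k_def K_def U1_def)
  qed (simp add: k_def K_def)
  have u2: "k p = 0 \<and> K p = 0" if p: "p \<in> U2" for p
  proof (cases "A \<le> s * fst p")
    case False
    then have "\<bar>fst p - a\<bar> \<le> \<tau>"
      using p s \<tau> unfolding U2_def A_def by auto
    then have "(C * A - g p) / w \<le> 0"
      using ga[of p] p w0 absa by (auto simp: U2_def divide_nonpos_pos)
    then show ?thesis
      using ramp_lower False p A \<tau> by (auto simp: k_def K_def U2_def)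
  qed (use p A \<tau> in \<open>auto simp: k_def K_def U2_def\<close>)
  have u3: "k p = ramp ((C * A - g p) / w)" "K p = - (dramp ((C * A - g p) / w) / w) *\<^sub>R G p"
    if "p \<in> U3" for p
    using that by (auto simp: k_def K_def U3_def)
  have gk: "GDERIV k p :> K p" if p: "p \<in> \<Omega>" for p
  proof -
    consider "p \<in> U1" | "p \<in> U2" | "p \<in> U3"
      using p cover by blast
    then show ?thesis
    proof cases
      case 1
      then have "(k has_derivative (\<lambda>_. 0)) (at p)"
        using has_derivative_transform_within_open[OF has_derivative_const op(1)] u1
        by metis
      then show ?thesis
        using u1[OF 1] by (simp add: gderiv_def)
    next
      case 2
      then have "(k has_derivative (\<lambda>_. 0)) (at p)"
        using has_derivative_transform_within_open[OF has_derivative_const op(2)] u2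
        by metis
      then show ?thesis
        using u2[OF 2] by (simp add: gderiv_def)
    next
      case 3
      have "((\<lambda>p. (C * A - g p) / w) has_derivative (\<lambda>e. - (e \<bullet> G p) / w)) (at p)"
        using gg[OF p] w0 unfolding gderiv_def by (auto intro!: derivative_eq_intros)
      from has_derivative_compose[OF this has_field_derivative_imp_has_derivative[OF has_real_derivative_ramp]]
      have "((\<lambda>p. ramp ((C * A - g p) / w)) has_derivative (\<lambda>e. e \<bullet> K p)) (at p)"
        unfolding u3(2)[OF 3] by simp
      then show ?thesis
        unfolding gderiv_def
        by (rule has_derivative_transform_within_open[OF _ op(3) 3]) (use u3 in auto)
    qed
  qed
  have cK: "continuous_on \<Omega> K"
  proof -
    have "continuous_on U1 K"
      by (rule continuous_on_eq[of _ "\<lambda>_. 0"]) (use u1 in auto)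
    moreover have "continuous_on U2 K"
      by (rule continuous_on_eq[of _ "\<lambda>_. 0"]) (use u2 in auto)
    moreover have "continuous_on U3 K"
    proof (rule continuous_on_eq)
      show "continuous_on U3 (\<lambda>p. - (dramp ((C * A - g p) / w) / w) *\<^sub>R G p)"
        using w0 cover closure_subset[of \<Omega>]
        by (intro continuous_intros continuous_on_subset[OF cG] continuous_on_subset[OF cg]) auto
    qed (use u3 in auto)
    ultimately show ?thesis
      unfolding cover by (intro continuous_on_open_Un op open_Un)
  qed
  have "- integral (bx M) (ext (\<lambda>p. sat d (diff p) * (K p \<bullet> X p))) \<le> e" if M: "A \<le> M" for M
  proof -
    let ?g = "\<lambda>p. - (sat d (diff p) * (K p \<bullet> X p))"
    have "- integral (bx M) (ext (\<lambda>p. sat d (diff p) * (K p \<bullet> X p))) = integral (bx M) (ext ?g)"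
      unfolding integral_neg[symmetric] by (rule integral_cong) (simp add: ext_def)
    also have "\<dots> \<le> 2 / w * ((A - N) * (2 * h)) + 0 * integral (slab s N A) (ext en)"
    proof (rule flux_bound[OF s])
      show "?g p \<le> 2 / w + 0 * en p" if p: "p \<in> \<Omega>" for p
      proof (cases "s * fst p \<le> N \<or> A \<le> s * fst p")
        case True
        then show ?thesis
          using w0 by (simp add: K_def)
      next
        case False
        define c where "c = sat d (diff p) * (dramp ((C * A - g p) / w) / w)"
        have c: "0 \<le> c"
          using sat_bounds[of d "diff p"] dramp_bounds[of "(C * A - g p) / w"] w0 by (simp add: c_def)
        have c': "c \<le> 1 * (2 / w)"
          unfolding c_def using sat_bounds[of d "diff p"] dramp_bounds[of "(C * A - g p) / w"] w0
          by (intro mult_mono divide_right_mono) auto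
        \<comment> \<open>The sign is such that only the upper bound on
          \<open>G p \<bullet> X p\<close> enters, never the size of \<open>G p\<close>.\<close>
        have "?g p = c * (G p \<bullet> X p)"
          using False by (simp add: K_def c_def)
        also have "\<dots> \<le> c * 1"
          using gX[OF p] c by (rule mult_left_mono)
        finally show ?thesis
          using c' by simp
      qed
      show "?g p = 0" if "s * fst p < N \<or> A < s * fst p" for p
        using that by (auto simp: K_def)
      show "continuous_on \<Omega> ?g"
        by (intro continuous_intros cdiff_dom cK contX)
    qed (use A N M w0 \<tau> sat_lower in auto)
    also have "\<dots> \<le> 2 / (C * A / 2) * (A * (2 * h))"
      using w A N h C \<tau> w0
      by (simp only: mult_zero_left add_0_right) (intro mult_mono divide_left_mono, auto)
    also have "\<dots> = e"
      using A(3) h e by (simp add: C_def field_simps)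
    finally show ?thesis .
  qed
  moreover have "0 \<le> k p \<and> k p \<le> 1" for p
    using ramp_bounds by (simp add: k_def)
  moreover have "k p = 0" if "A \<le> s * fst p" for p
    using that A \<tau> by (simp add: k_def)
  ultimately have "cutoff s N A e k K"
    unfolding cutoff_def using gk cK by (auto simp: k_def K_def)
  then show ?thesis
    by blast
qed

text \<open>Zero energy on every box makes the two gradients agree wherever the difference exceeds
  \<open>d\<close>. So \<open>\<chi>(\<phi>)\<close> is constant along each segment across the
  strip, and it is 0 at the end of the segment on the edge.\<close>

lemma diff_le:
  assumes cut: "\<And>s N e. s = 1 \<or> s = - 1 \<Longrightarrow> 0 \<le> N \<Longrightarrow> 0 < e \<Longrightarrow> \<exists>M k K. cutoff s N M e k K"
    and p: "p \<in> closure \<Omega>"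
  shows "diff p \<le> d"
proof -
  have en0: "en p = 0" if p: "p \<in> \<Omega>" for p
  proof -
    define N where "N = \<bar>fst p\<bar> + 1"
    have N: "0 \<le> N" "0 < N"
      by (auto simp: N_def)
    have "integral (bx N) (ext en) \<le> 0"
    proof (rule field_le_epsilon)
      fix e :: real assume "0 < e"
      then have e2: "0 < e / 2"
        by simp
      obtain M1 k1 K1 M2 k2 K2 where "cutoff 1 N M1 (e / 2) k1 K1" "cutoff (- 1) N M2 (e / 2) k2 K2"
        using cut[of 1 N "e / 2", OF _ N(1) e2] cut[of "- 1" N "e / 2", OF _ N(1) e2] by auto
      from energy_le[OF this N(1)] show "integral (bx N) (ext en) \<le> 0 + e"
        by simp
    qed
    moreover have "0 \<le> integral (bx N) (ext en)"
      by (rule integral_nonneg[OF integrable_bx[OF cont_ext_en]]) (rule ext_en_nonneg)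
    ultimately have "(ext en has_integral 0) (bx N)"
      using integrable_integral[OF integrable_bx[OF cont_ext_en]] by (metis antisym)
    moreover have "box (- N, - h) (N, h) \<noteq> {}"
      using N h by (auto simp: box_ne_empty Basis_prod_def)
    moreover have "p \<in> bx N"
      using p by (auto simp: mem_bx mem_dom N_def)
    ultimately have "ext en p = 0"
      unfolding bx_def using has_integral_0_cbox_imp_0[OF cont_ext_en] ext_en_nonneg by blast
    then show ?thesis
      using p by (simp add: ext_def)
  qed
  obtain x y where xy: "p = (x, y)"
    by (cases p)
  have y: "- h \<le> y" "y \<le> h"
    using p unfolding closure_dom xy by auto
  let ?g = "\<lambda>t. sat d (diff (x, t))"
  have "?g y = ?g h"
  proof (cases "y = h")
    case False
    have "?g h = ?g y"
    proof (rule DERIV_isconst_end[where f = ?g and a = y and b = h])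
      show "y < h"
        using y False by simp
      have "continuous_on {y..h} (\<lambda>t. diff (x, t))"
        by (rule continuous_on_compose2[OF cdiff]) (use y in \<open>auto intro!: continuous_intros simp: closure_dom\<close>)
      then show "continuous_on {y..h} ?g"
        by (rule continuous_on_sat)
      fix t assume t: "y < t" "t < h"
      then have dom: "(x, t) \<in> \<Omega>"
        using y by (auto simp: mem_dom)
      let ?D = "Gu (x, t) - Gv (x, t)"
      have "((\<lambda>t. (x, t)) has_derivative (\<lambda>e. (0, e))) (at t)"
        by (auto intro!: derivative_eq_intros)
      note 1 = has_derivative_compose[OF this gdiff[OF dom, unfolded gderiv_def]]
      have "((\<lambda>t. diff (x, t)) has_real_derivative snd ?D) (at t)"
        unfolding has_field_derivative_def
        by (rule has_derivative_eq_rhs[OF 1]) (auto simp: fun_eq_iff inner_prod_def mult.commute)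
      from DERIV_chain2[OF has_real_derivative_sat this]
      have "(?g has_real_derivative dsat d (diff (x, t)) * snd ?D) (at t)" .
      moreover have "dsat d (diff (x, t)) * snd ?D = 0"
      proof (cases "dsat d (diff (x, t)) = 0")
        case False
        then have "?D \<bullet> X (x, t) = 0"
          using en0[OF dom] by (simp add: en_def)
        then show ?thesis
          using nmap_monotone_strict unfolding X_def by fastforce
      qed simp
      ultimately show "(?g has_real_derivative 0) (at t)"
        by (simp only:)
    qed
    then show ?thesis
      by simp
  qed simp
  moreover have "diff (x, h) = 0"
    by (rule diff_frontier) (simp add: frontier_dom)
  ultimately have "sat d (diff p) = 0"
    using sat_lower[of 0 d] d xy by simp
  then show ?thesis
    using sat_pos[of d "diff p"] by (cases "d < diff p") auto
qed

end

section \<open>Touching graphs and barriers\<close>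

lemma second_order_max:
  fixes g :: "'a::euclidean_space \<Rightarrow> real"
  assumes S: "open S" "p \<in> S" and G: "\<And>q. q \<in> S \<Longrightarrow> GDERIV g q :> G q"
    and B: "(G has_derivative B) (at p)" and max: "\<And>q. q \<in> S \<Longrightarrow> g q \<le> g p"
  shows "G p = 0" and "B e \<bullet> e \<le> 0"
proof -
  have "(\<lambda>e. e \<bullet> G p) = (\<lambda>e. 0)"
    using differential_zero_maxmin[OF S(2,1) _ disjI1, of g "\<lambda>e. e \<bullet> G p"] G[OF S(2)] max
    by (auto simp: gderiv_def)
  then show G0: "G p = 0"
    by (metis inner_eq_zero_iff)
  show "B e \<bullet> e \<le> 0"
  proof (rule ccontr)
    assume "\<not> B e \<bullet> e \<le> 0"
    then have pos: "0 < B e \<bullet> e"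
      by simp
    have line: "((\<lambda>s. p + s *\<^sub>R e) has_derivative (\<lambda>t. t *\<^sub>R e)) (at s)" for s :: real
      by (auto intro!: derivative_eq_intros)
    have "isCont (\<lambda>s. p + s *\<^sub>R e) 0"
      by (intro continuous_intros)
    then have "\<forall>\<^sub>F s in at 0. p + s *\<^sub>R e \<in> S"
      using S by (auto simp: isCont_def intro!: topological_tendstoD)
    then obtain r where r: "0 < r" "\<And>s. s \<noteq> 0 \<Longrightarrow> \<bar>s\<bar> < r \<Longrightarrow> p + s *\<^sub>R e \<in> S"
      unfolding eventually_at by (auto simp: dist_real_def)
    have inS: "p + s *\<^sub>R e \<in> S" if "\<bar>s\<bar> < r" for s
      using r(2)[of s] that S(2) by (cases "s = 0") auto
    have f': "((\<lambda>s. g (p + s *\<^sub>R e)) has_real_derivative G (p + s *\<^sub>R e) \<bullet> e) (at s)"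
      if "\<bar>s\<bar> < r" for s
      using has_derivative_compose[OF line G[OF inS[OF that], unfolded gderiv_def]]
      unfolding has_field_derivative_def
      by (rule has_derivative_eq_rhs) (auto simp: fun_eq_iff inner_commute)
    have B0: "(G has_derivative B) (at (p + 0 *\<^sub>R e))"
      using B by simp
    have "((\<lambda>s. G (p + s *\<^sub>R e) \<bullet> e) has_derivative (\<lambda>t. B (t *\<^sub>R e) \<bullet> e)) (at 0)"
      by (rule has_derivative_inner_left[OF has_derivative_compose[OF line B0]])
    then have "((\<lambda>s. G (p + s *\<^sub>R e) \<bullet> e) has_real_derivative B e \<bullet> e) (at 0)"
      unfolding has_field_derivative_def
      by (rule has_derivative_eq_rhs)
        (auto simp: fun_eq_iff linear_scale[OF has_derivative_linear[OF B]])
    from DERIV_pos_inc_right[OF this pos] obtain m where m: "0 < m"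
      "\<And>t. 0 < t \<Longrightarrow> t < m \<Longrightarrow> 0 < G (p + t *\<^sub>R e) \<bullet> e"
      using G0 by auto
    define t where "t = min m r / 2"
    have t: "0 < t" "t < m" "t < r"
      using m(1) r(1) by (auto simp: t_def min_def)
    have "\<exists>z>0. z < t \<and> g (p + t *\<^sub>R e) - g (p + 0 *\<^sub>R e) = (t - 0) * (G (p + z *\<^sub>R e) \<bullet> e)"
      using t f' by (intro MVT2) auto
    then obtain z where z: "0 < z" "z < t" "g (p + t *\<^sub>R e) - g p = t * (G (p + z *\<^sub>R e) \<bullet> e)"
      by auto
    then have "0 < g (p + t *\<^sub>R e) - g p"
      using m(2)[of z] t by simp
    then show False
      using max[OF inS[of t]] t by simp
  qed
qed

lemma graph_div_diff:
  "graph_div q B - graph_div q B' = graph_div q (\<lambda>e. B e - B' e)"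
  unfolding graph_div_def sum_subtractf[symmetric]
  by (rule sum.cong) (auto simp: dnmap_def inner_diff_left inner_diff_right diff_divide_distrib algebra_simps)

text \<open>Ellipticity: \<open>W^3\<close> times the operator is the trace of \<open>B\<close> plus
  the quadratic form of \<open>B\<close> at \<open>(- q2, q1)\<close>, the gradient turned by a
  right angle.\<close>

lemma graph_div_nonpos:
  fixes B :: "real \<times> real \<Rightarrow> real \<times> real"
  assumes B: "linear B" and le: "\<And>e. B e \<bullet> e \<le> 0"
  shows "graph_div q B \<le> 0"
proof -
  obtain q1 q2 where q: "q = (q1, q2)"
    by (cases q)
  obtain b11 b21 b12 b22 where b: "B (1, 0) = (b11, b21)" "B (0, 1) = (b12, b22)"
    by (cases "B (1, 0)"; cases "B (0, 1)")
  define W where "W = sqrt (1 + (norm q)\<^sup>2)"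
  have W: "0 < W" "W\<^sup>2 = 1 + q1\<^sup>2 + q2\<^sup>2"
    by (simp_all add: W_def add_pos_nonneg q norm_Pair)
  have "B (- q2, q1) = B ((- q2) *\<^sub>R (1, 0) + q1 *\<^sub>R (0, 1))"
    by simp
  also have "\<dots> = (- q2) *\<^sub>R B (1, 0) + q1 *\<^sub>R B (0, 1)"
    by (simp only: linear_add[OF B] linear_scale[OF B])
  finally have "B (- q2, q1) = (q1 * b12 - q2 * b11, q1 * b22 - q2 * b21)"
    by (simp add: b)
  then have 1: "q2\<^sup>2 * b11 - q1 * q2 * (b12 + b21) + q1\<^sup>2 * b22 \<le> 0"
    using le[of "(- q2, q1)"] by (simp add: power2_eq_square algebra_simps)
  have 2: "b11 \<le> 0" "b22 \<le> 0"
    using le[of "(1, 0)"] le[of "(0, 1)"] by (simp_all add: b)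
  have "graph_div q B = (b11 / W - (q1 * b11 + q2 * b21) / W ^ 3 * q1) + (b22 / W - (q1 * b12 + q2 * b22) / W ^ 3 * q2)"
    unfolding graph_div_def sum_Basis_real_prod by (simp add: dnmap_def b W_def[symmetric]) (simp add: q)
  also have "\<dots> = (W\<^sup>2 * (b11 + b22) - (q1 * b11 + q2 * b21) * q1 - (q1 * b12 + q2 * b22) * q2) / W ^ 3"
    using W(1) by (simp add: field_simps power2_eq_square power3_eq_cube)
  also have "W\<^sup>2 * (b11 + b22) - (q1 * b11 + q2 * b21) * q1 - (q1 * b12 + q2 * b22) * q2
    = b11 + b22 + (q2\<^sup>2 * b11 - q1 * q2 * (b12 + b21) + q1\<^sup>2 * b22)"
    unfolding W(2) by (simp add: power2_eq_square algebra_simps)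
  finally show ?thesis
    using 1 2 W(1) by (simp add: divide_nonpos_pos)
qed

text \<open>At the maximum the gradients agree, and for a common gradient the operator is linear in
  the Hessian, so ellipticity applies to the difference of the Hessians.\<close>

lemma graph_div_touching:
  fixes w v :: "real \<times> real \<Rightarrow> real"
  assumes S: "open S" "p \<in> S"
    and Gw: "\<And>q. q \<in> S \<Longrightarrow> GDERIV w q :> Gw q" and Gv: "\<And>q. q \<in> S \<Longrightarrow> GDERIV v q :> Gv q"
    and Bw: "(Gw has_derivative Bw) (at p)" and Bv: "(Gv has_derivative Bv) (at p)"
    and max: "\<And>q. q \<in> S \<Longrightarrow> w q - v q \<le> w p - v p"
  shows "graph_div (Gw p) Bw \<le> graph_div (Gv p) Bv"
proof -
  have B: "((\<lambda>q. Gw q - Gv q) has_derivative (\<lambda>e. Bw e - Bv e)) (at p)"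
    by (intro has_derivative_diff Bw Bv)
  note so = second_order_max[OF S GDERIV_diff[OF Gw Gv] B max]
  have "graph_div (Gv p) (\<lambda>e. Bw e - Bv e) \<le> 0"
    using so(2) by (intro graph_div_nonpos has_derivative_linear[OF B])
  then show ?thesis
    using so(1) graph_div_diff[of "Gv p" Bw Bv] by simp
qed

text \<open>Lets the mean curvature of a barrier be read off a closed formula \<open>Z\<close> for
  the horizontal part of its normal; of its Hessian only the existence has to be shown.\<close>

lemma graph_div_field:
  assumes "open S" "p \<in> S" "\<And>q. q \<in> S \<Longrightarrow> nmap (G q) = Z q"
    and "(G has_derivative B) (at p)" "(Z has_derivative D) (at p)"
  shows "graph_div (G p) B = (\<Sum>b\<in>Basis. D b \<bullet> b)"
proof -
  have "(Z has_derivative (\<lambda>e. dnmap (G p) (B e))) (at p)"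
    by (rule has_derivative_transform_within_open[OF has_derivative_nmap[OF assms(4)] assms(1,2,3)])
  from has_derivative_unique[OF this assms(5)] show ?thesis
    by (auto simp: graph_div_def fun_eq_iff)
qed

text \<open>Square-root growth of \<open>w\<close> along \<open>e\<close> beats the at most linear
  growth of the differentiable \<open>v\<close>, so \<open>w - v\<close> would increase. This
  excludes contact where a barrier has a vertical tangent.\<close>

lemma steep_no_max:
  fixes w v :: "'a::real_normed_vector \<Rightarrow> real"
  assumes D: "(v has_derivative D) (at q)" and k: "0 < k" and \<delta>: "0 < \<delta>"
    and steep: "\<And>s. 0 < s \<Longrightarrow> s < \<delta> \<Longrightarrow> w q + k * sqrt s \<le> w (q + s *\<^sub>R e)"
    and max: "\<And>s. 0 < s \<Longrightarrow> s < \<delta> \<Longrightarrow> w (q + s *\<^sub>R e) - v (q + s *\<^sub>R e) \<le> w q - v q"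
  shows False
proof -
  have line: "((\<lambda>s. q + s *\<^sub>R e) has_derivative (\<lambda>t. t *\<^sub>R e)) (at 0)"
    by (auto intro!: derivative_eq_intros)
  have "(v has_derivative D) (at (q + 0 *\<^sub>R e))"
    using D by simp
  from has_derivative_compose[OF line this]
  have "((\<lambda>s. v (q + s *\<^sub>R e)) has_real_derivative D e) (at 0)"
    unfolding has_field_derivative_def
    by (rule has_derivative_eq_rhs) (auto simp: fun_eq_iff linear_scale[OF has_derivative_linear[OF D]])
  then have "((\<lambda>s. (v (q + s *\<^sub>R e) - v q) / s) \<longlongrightarrow> D e) (at 0)"
    by (simp add: DERIV_def)
  then have "\<forall>\<^sub>F s in at 0. (v (q + s *\<^sub>R e) - v q) / s < \<bar>D e\<bar> + 1"
    by (rule order_tendstoD) auto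
  then obtain r where r: "0 < r" "\<And>s. s \<noteq> 0 \<Longrightarrow> \<bar>s\<bar> < r \<Longrightarrow> (v (q + s *\<^sub>R e) - v q) / s < \<bar>D e\<bar> + 1"
    unfolding eventually_at by (auto simp: dist_real_def)
  define L where "L = \<bar>D e\<bar> + 1"
  have L: "0 < L"
    by (simp add: L_def add_nonneg_pos)
  \<comment> \<open>Below \<open>(k / L)^2\<close> one has
    \<open>L * s < k * sqrt s\<close>.\<close>
  define s where "s = min (min r \<delta>) ((k / L)\<^sup>2) / 2"
  have s: "0 < s" "s < r" "s < \<delta>" "s < (k / L)\<^sup>2"
    using r(1) \<delta> k L by (auto simp: s_def min_def)
  have "k * sqrt s \<le> v (q + s *\<^sub>R e) - v q"
    using steep[OF s(1,3)] max[OF s(1,3)] by simp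
  also have "\<dots> \<le> L * s"
    using r(2)[of s] s by (simp add: L_def field_simps)
  also have "\<dots> = L * sqrt s * sqrt s"
    using s(1) by simp
  finally have "k \<le> L * sqrt s"
    using s(1) by simp
  moreover have "sqrt s < k / L"
    using s(4) k L by (simp add: real_less_lsqrt s(1) less_imp_le)
  ultimately show False
    using L by (simp add: field_simps)
qed

text \<open>The height of a circular arc after moving from its end by the fraction \<open>s\<close>
  towards the centre: \<open>1 - (1 - s)^2 = 2 * s - s^2 \<ge> s\<close>.\<close>

lemma sqrt_steep:
  assumes "0 < r" "0 < s" "s < 1" "\<bar>z\<bar> = r"
  shows "r * sqrt s \<le> sqrt (r\<^sup>2 - ((1 - s) * z)\<^sup>2)"
proof (rule real_le_rsqrt)
  have z: "z\<^sup>2 = r\<^sup>2"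
    using assms(4) by (metis power2_abs)
  have "r\<^sup>2 - ((1 - s) * z)\<^sup>2 = r\<^sup>2 * (2 * s - s\<^sup>2)"
    unfolding power_mult_distrib z by (simp add: power2_eq_square algebra_simps)
  moreover have "s \<le> 2 * s - s\<^sup>2"
    using assms(2,3) by (simp add: power2_eq_square)
  ultimately show "(r * sqrt s)\<^sup>2 \<le> r\<^sup>2 - ((1 - s) * z)\<^sup>2"
    using assms(2) by (simp add: power_mult_distrib mult_left_mono)
qed

text \<open>
  Comparison with a hemisphere of mean curvature \<open>H / 2\<close>. Its vertical tangents exclude a contact
  over the lateral arcs, so that no bound on the graph is needed there.
\<close>

lemma upper_barrier:
  fixes u :: "real \<times> real \<Rightarrow> real"
  assumes H: "0 < H" and h: "0 < h" "h \<le> 2 / H" and \<Omega>: "\<Omega> = UNIV \<times> {- h<..<h}"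
    and cu: "continuous_on (closure \<Omega>) u" and gu: "graph_on \<Omega> u G B"
    and div: "\<And>p. p \<in> \<Omega> \<Longrightarrow> graph_div (G p) (B p) = 2 * H"
    and M: "\<And>p. p \<in> frontier \<Omega> \<Longrightarrow> \<bar>fst p - x\<bar> \<le> 2 / H \<Longrightarrow> u p \<le> M"
    and p: "p \<in> \<Omega>" "fst p = x"
  shows "u p \<le> M + 2 / H"
proof -
  define R where "R = 2 / H"
  have R: "0 < R" "h \<le> R"
    using H h by (auto simp: R_def)
  define c where "c = (x, 0::real)"
  \<comment> \<open>The lower hemisphere. Its operator is \<open>2 / R = H\<close>, so a contact of
    \<open>u\<close> from below in the interior would force \<open>2 * H \<le> H\<close>.\<close>
  define w where "w q = - sqrt (R\<^sup>2 - (norm (q - c))\<^sup>2)" for q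
  define D where "D = closure \<Omega> \<inter> cball c R"
  have opn: "open \<Omega>"
    unfolding \<Omega> by (simp add: open_Times)
  have "compact D"
    unfolding D_def by (simp add: closed_Int_compact)
  moreover have pc: "norm (p - c) \<le> R"
    using p R(2) unfolding \<Omega> c_def by (cases p) (auto simp: norm_Pair)
  then have pD: "p \<in> D"
    using p closure_subset by (auto simp: D_def dist_norm norm_minus_commute)
  moreover have "continuous_on D (\<lambda>q. u q - w q)"
    unfolding w_def D_def by (intro continuous_intros continuous_on_subset[OF cu]) auto
  ultimately obtain q where q: "q \<in> D" "\<And>z. z \<in> D \<Longrightarrow> u z - w z \<le> u q - w q"
    using continuous_attains_sup[of D] by blast
  have nq: "norm (q - c) \<le> R"
    using q(1) by (auto simp: D_def dist_norm norm_minus_commute)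
  have wle: "w z \<le> 0" if "norm (z - c) \<le> R" for z
    unfolding w_def using power_mono[OF that, of 2] by simp
  have "q \<notin> \<Omega>"
  proof
    assume qO: "q \<in> \<Omega>"
    show False
    proof (cases "norm (q - c) = R")
      case True
      \<comment> \<open>Signs are reversed for \<open>steep_no_max\<close>: it is \<open>- w\<close>
        that rises steeply from the rim towards the centre.\<close>
      have uD: "((\<lambda>z. - u z) has_derivative (\<lambda>e. - (e \<bullet> G q))) (at q)"
        using gu qO unfolding graph_on_def gderiv_def by (intro has_derivative_minus) auto
      have eq: "q + s *\<^sub>R (c - q) - c = (1 - s) *\<^sub>R (q - c)" for s
        by (simp add: algebra_simps)
      have "isCont (\<lambda>s. q + s *\<^sub>R (c - q)) 0"
        by (intro continuous_intros)
      then have "\<forall>\<^sub>F s in at 0. q + s *\<^sub>R (c - q) \<in> \<Omega>"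
        using qO opn by (auto simp: isCont_def intro!: topological_tendstoD)
      then obtain r where r: "0 < r" "\<And>s. s \<noteq> 0 \<Longrightarrow> \<bar>s\<bar> < r \<Longrightarrow> q + s *\<^sub>R (c - q) \<in> \<Omega>"
        unfolding eventually_at by (auto simp: dist_real_def)
      show False
      proof (rule steep_no_max[OF uD R(1), where w = "\<lambda>z. - w z" and \<delta> = "min r 1" and e = "c - q"])
        fix s assume s: "0 < s" "s < min r 1"
        have n: "norm (q + s *\<^sub>R (c - q) - c) = (1 - s) * R"
          unfolding eq using s True by simp
        show "- w q + R * sqrt s \<le> - w (q + s *\<^sub>R (c - q))"
          using sqrt_steep[of R s R] s R(1) True unfolding w_def n by simp
        have "(1 - s) * R \<le> 1 * R"
          using s R(1) by (intro mult_right_mono) auto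
        then have "q + s *\<^sub>R (c - q) \<in> D"
          using r(2)[of s] s n closure_subset[of \<Omega>] by (auto simp: D_def dist_norm norm_minus_commute)
        from q(2)[OF this]
        show "- w (q + s *\<^sub>R (c - q)) - - u (q + s *\<^sub>R (c - q)) \<le> - w q - - u q"
          by simp
      qed (use r(1) in auto)
    next
      case False
      define S where "S = \<Omega> \<inter> ball c R"
      define Gw where "Gw z = (1 / sqrt (R\<^sup>2 - (norm (z - c))\<^sup>2)) *\<^sub>R (z - c)" for z
      have S: "open S" "q \<in> S"
        using opn qO nq False by (auto simp: S_def dist_norm norm_minus_commute)
      have pos: "0 < R\<^sup>2 - (norm (z - c))\<^sup>2" if "z \<in> S" for z
        using that power_strict_mono[of "norm (z - c)" R 2] by (auto simp: S_def dist_norm norm_minus_commute)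
      have sq: "((\<lambda>z. R\<^sup>2 - (norm (z - c))\<^sup>2) has_derivative (\<lambda>e. - 2 * (e \<bullet> (z - c)))) (at z)" for z
        unfolding power2_norm_eq_inner by (auto intro!: derivative_eq_intros simp: inner_commute)
      have gw: "GDERIV w z :> Gw z" if "z \<in> S" for z
      proof -
        have "((\<lambda>t. - sqrt t) has_real_derivative - (1 / (2 * sqrt (R\<^sup>2 - (norm (z - c))\<^sup>2)))) (at (R\<^sup>2 - (norm (z - c))\<^sup>2))"
          using pos[OF that] by (auto intro!: derivative_eq_intros simp: inverse_eq_divide)
        from has_derivative_compose[OF sq has_field_derivative_imp_has_derivative[OF this]]
        show ?thesis
          unfolding gderiv_def w_def[abs_def] Gw_def by (simp add: inner_commute)
      qed
      have "\<exists>Bw. (Gw has_derivative Bw) (at q)"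
        unfolding Gw_def[abs_def]
        by (rule exI, rule has_derivative_scaleR[OF has_derivative_divide[OF has_derivative_const has_derivative_real_sqrt[OF _ sq]]])
          (use pos[OF S(2)] in \<open>auto intro!: derivative_intros\<close>)
      then obtain Bw where Bw: "(Gw has_derivative Bw) (at q)" ..
      have nm: "nmap (Gw z) = (1 / R) *\<^sub>R (z - c)" if z: "z \<in> S" for z
      proof -
        let ?t = "sqrt (R\<^sup>2 - (norm (z - c))\<^sup>2)"
        have t: "0 < ?t" "?t\<^sup>2 = R\<^sup>2 - (norm (z - c))\<^sup>2"
          using pos[OF z] by auto
        have "(norm (Gw z))\<^sup>2 = (norm (z - c))\<^sup>2 / ?t\<^sup>2"
          by (simp add: Gw_def power_divide power_mult_distrib)
        also have "1 + \<dots> = (R / ?t)\<^sup>2"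
          using t by (simp add: power_divide field_simps)
        finally have "sqrt (1 + (norm (Gw z))\<^sup>2) = R / ?t"
          using R(1) t(1) by (simp add: abs_of_nonneg less_imp_le)
        then show ?thesis
          using t(1) by (simp add: nmap_def Gw_def)
      qed
      have dz: "((\<lambda>z. (1 / R) *\<^sub>R (z - c)) has_derivative (\<lambda>e. (1 / R) *\<^sub>R e)) (at q)"
        by (auto intro!: derivative_eq_intros)
      have "graph_div (Gw q) Bw = (\<Sum>b\<in>(Basis :: (real \<times> real) set). ((1 / R) *\<^sub>R b) \<bullet> b)"
        by (rule graph_div_field[OF S nm Bw dz])
      also have "\<dots> = H"
        using H unfolding sum_Basis_real_prod by (simp add: R_def)
      finally have dw: "graph_div (Gw q) Bw = H" .
      have "graph_div (G q) (B q) \<le> graph_div (Gw q) Bw"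
      proof (rule graph_div_touching[OF S _ gw _ Bw])
        show "(G has_derivative B q) (at q)"
          using gu qO by (simp add: graph_on_def)
        show "GDERIV u z :> G z" if "z \<in> S" for z
          using gu that by (auto simp: graph_on_def S_def)
        show "u z - w z \<le> u q - w q" if "z \<in> S" for z
          using q(2)[of z] that closure_subset[of \<Omega>] by (auto simp: S_def D_def)
      qed
      then show False
        using dw div[OF qO] H by simp
    qed
  qed
  then have "q \<in> frontier \<Omega>"
    using q(1) by (auto simp: D_def frontier_def interior_open[OF opn])
  moreover have "\<bar>fst q - x\<bar> \<le> R"
    using nq norm_fst_le[of "fst (q - c)" "snd (q - c)"] by (cases q) (simp add: c_def)
  ultimately have "u q \<le> M"
    using M by (simp add: R_def)
  moreover have "- w q \<le> R"
    unfolding w_def using R(1) by (simp add: real_sqrt_le_iff real_le_lsqrt)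
  ultimately show ?thesis
    using q(2)[OF pD] wle[OF pc] by (simp add: R_def)
qed

text \<open>
  The profile of a surface of revolution about a horizontal axis, as a radius \<open>r\<close> over the axis.
  The sine \<open>\<sigma>\<close> of its slope angle is the conormal component along the axis.
\<close>

definition nodoid_profile :: "real \<Rightarrow> real \<Rightarrow> (real \<Rightarrow> real) \<Rightarrow> (real \<Rightarrow> real) \<Rightarrow> bool" where
  "nodoid_profile k H r \<sigma> \<longleftrightarrow> continuous_on {- k..k} r \<and> (\<forall>y\<in>{- k<..<k}. 0 < r y \<and> \<bar>\<sigma> y\<bar> < 1 \<and>
     (r has_real_derivative \<sigma> y / sqrt (1 - (\<sigma> y)\<^sup>2)) (at y) \<and>
     (\<sigma> has_real_derivative 2 * H + sqrt (1 - (\<sigma> y)\<^sup>2) / r y) (at y))"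

text \<open>A homothety keeps slope angles and divides the mean curvature by its ratio, so ratios
  below 1 raise \<open>H\<close> strictly.\<close>

lemma nodoid_profile_scale:
  assumes P: "nodoid_profile k H r \<sigma>" and l: "0 < l"
  shows "nodoid_profile (l * k) (H / l) (\<lambda>y. l * r (y / l)) (\<lambda>y. \<sigma> (y / l))"
  unfolding nodoid_profile_def
proof (intro conjI ballI)
  have in_iv: "y / l \<in> {- k..k}" if "y \<in> {- (l * k)..l * k}" for y
    using that l by (auto simp: field_simps)
  then show "continuous_on {- (l * k)..l * k} (\<lambda>y. l * r (y / l))"
    using P l unfolding nodoid_profile_def
    by (intro continuous_intros continuous_on_compose2[where f = "\<lambda>y. y / l" and g = r and t = "{- k..k}"]) auto
  fix y assume "y \<in> {- (l * k)<..<l * k}"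
  then have y: "y / l \<in> {- k<..<k}"
    using l by (auto simp: field_simps)
  with P have p: "0 < r (y / l)" "\<bar>\<sigma> (y / l)\<bar> < 1"
    "(r has_real_derivative \<sigma> (y / l) / sqrt (1 - (\<sigma> (y / l))\<^sup>2)) (at (y / l))"
    "(\<sigma> has_real_derivative 2 * H + sqrt (1 - (\<sigma> (y / l))\<^sup>2) / r (y / l)) (at (y / l))"
    unfolding nodoid_profile_def by auto
  show "0 < l * r (y / l)" "\<bar>\<sigma> (y / l)\<bar> < 1"
    using p l by auto
  have d: "((\<lambda>y. y / l) has_real_derivative 1 / l) (at y)"
    using l by (auto intro!: derivative_eq_intros)
  show "((\<lambda>y. l * r (y / l)) has_real_derivative \<sigma> (y / l) / sqrt (1 - (\<sigma> (y / l))\<^sup>2)) (at y)"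
    using DERIV_cmult[OF DERIV_chain2[OF p(3) d], of l] l by simp
  show "((\<lambda>y. \<sigma> (y / l)) has_real_derivative
      2 * (H / l) + sqrt (1 - (\<sigma> (y / l))\<^sup>2) / (l * r (y / l))) (at y)"
    using DERIV_chain2[OF p(4) d] l by (simp add: add_divide_distrib mult.commute)
qed

text \<open>The barrier is the upper half of the surface of revolution about the horizontal line
  over \<open>x = a\<close> at height \<open>b\<close>. A maximum of \<open>w - v\<close> cannot lie
  inside, where \<open>H < H'\<close> contradicts \<open>graph_div_touching\<close>, nor on the
  sides \<open>|x - a| = r y\<close>, where the barrier is vertical. It lies over an end
  \<open>|y| = k\<close>, where \<open>bd\<close> applies.\<close>

lemma nodoid_barrier_strict:
  fixes v :: "real \<times> real \<Rightarrow> real"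
  assumes P: "nodoid_profile k H' r \<sigma>" and H: "H < H'" and k: "0 < k" "k < h"
    and rk: "0 \<le> r k" "0 \<le> r (- k)"
    and \<Omega>: "\<Omega> = UNIV \<times> {- h<..<h}" and gv: "graph_on \<Omega> v G B"
    and div: "\<And>p. p \<in> \<Omega> \<Longrightarrow> graph_div (G p) (B p) = 2 * H"
    and bd: "\<And>x y. \<bar>y\<bar> = k \<Longrightarrow> \<bar>x - a\<bar> \<le> r y \<Longrightarrow> b + sqrt ((r y)\<^sup>2 - (x - a)\<^sup>2) \<le> v (x, y)"
    and p: "\<bar>y0\<bar> \<le> k" "\<bar>x0 - a\<bar> \<le> r y0"
  shows "b + sqrt ((r y0)\<^sup>2 - (x0 - a)\<^sup>2) \<le> v (x0, y0)"
proof -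
  have cr: "continuous_on {- k..k} r"
    and pr: "\<And>y. y \<in> {- k<..<k} \<Longrightarrow> 0 < r y" "\<And>y. y \<in> {- k<..<k} \<Longrightarrow> \<bar>\<sigma> y\<bar> < 1"
    "\<And>y. y \<in> {- k<..<k} \<Longrightarrow> (r has_real_derivative \<sigma> y / sqrt (1 - (\<sigma> y)\<^sup>2)) (at y)"
    "\<And>y. y \<in> {- k<..<k} \<Longrightarrow> (\<sigma> has_real_derivative 2 * H' + sqrt (1 - (\<sigma> y)\<^sup>2) / r y) (at y)"
    using P unfolding nodoid_profile_def by auto
  have opn: "open \<Omega>"
    unfolding \<Omega> by (simp add: open_Times)
  obtain R where R: "\<And>y. y \<in> {- k..k} \<Longrightarrow> r y \<le> R"
    using continuous_attains_sup[OF compact_Icc _ cr] k(1) by fastforce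
  define Q where "Q = cbox (a - R, - k) (a + R, k)"
  define w where "w q = b + sqrt ((r (snd q))\<^sup>2 - (fst q - a)\<^sup>2)" for q :: "real \<times> real"
  define D where "D = {q. \<bar>snd q\<bar> \<le> k \<and> \<bar>fst q - a\<bar> \<le> r (snd q)}"
  have Qmem: "q \<in> Q \<longleftrightarrow> \<bar>fst q - a\<bar> \<le> R \<and> \<bar>snd q\<bar> \<le> k" for q
    unfolding Q_def by (cases q) (auto simp: abs_le_iff)
  have "q \<in> D \<longleftrightarrow> q \<in> Q \<inter> (\<lambda>q. r (snd q) - \<bar>fst q - a\<bar>) -` {0..}" for q
    using R[of "snd q"] by (auto simp: D_def Qmem abs_le_iff)
  then have DQ: "D = Q \<inter> (\<lambda>q. r (snd q) - \<bar>fst q - a\<bar>) -` {0..}"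
    by blast
  have crs: "continuous_on Q (\<lambda>q. r (snd q))"
    by (rule continuous_on_compose2[OF cr]) (auto intro!: continuous_intros simp: Qmem abs_le_iff)
  have "closed D"
    unfolding DQ by (intro continuous_closed_preimage continuous_intros crs closed_atLeast)
      (simp only: Q_def closed_cbox)
  moreover have "bounded D"
    by (rule bounded_subset[of Q]) (simp only: Q_def bounded_cbox, simp add: DQ)
  ultimately have "compact D"
    by (simp add: compact_eq_bounded_closed)
  moreover have pD: "(x0, y0) \<in> D"
    using p by (simp add: D_def)
  moreover have D\<Omega>: "D \<subseteq> \<Omega>"
    using k by (auto simp: D_def \<Omega>)
  then have "continuous_on D (\<lambda>q. w q - v q)"
    unfolding w_def DQ
    by (intro continuous_intros continuous_on_subset[OF crs] continuous_on_subset[OF graph_on_continuous(2)[OF gv]]) auto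
  ultimately obtain q where q: "q \<in> D" "\<And>z. z \<in> D \<Longrightarrow> w z - v z \<le> w q - v q"
    using continuous_attains_sup[of D] by blast
  obtain x y where xy: "q = (x, y)"
    by (cases q)
  have qD: "\<bar>y\<bar> \<le> k" "\<bar>x - a\<bar> \<le> r y"
    using q(1) by (auto simp: D_def xy)
  have qO: "q \<in> \<Omega>"
    using q(1) D\<Omega> by blast
  have "\<bar>y\<bar> = k"
  proof (rule ccontr)
    assume "\<bar>y\<bar> \<noteq> k"
    then have y: "y \<in> {- k<..<k}"
      using qD(1) by auto
    show False
    proof (cases "\<bar>x - a\<bar> = r y")
      case True
      have vD: "(v has_derivative (\<lambda>e. e \<bullet> G q)) (at q)"
        using gv qO unfolding graph_on_def gderiv_def by auto
      show False
      proof (rule steep_no_max[OF vD pr(1)[OF y], where w = w and \<delta> = 1 and e = "(a - x, 0)"])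
        fix s :: real assume s: "0 < s" "s < 1"
        have eq: "q + s *\<^sub>R (a - x, 0) = (a + (1 - s) * (x - a), y)"
          by (simp add: xy algebra_simps)
        show "w q + r y * sqrt s \<le> w (q + s *\<^sub>R (a - x, 0))"
          using sqrt_steep[OF pr(1)[OF y] s True] power2_abs[of "x - a"] True unfolding eq by (simp add: w_def xy)
        have "(1 - s) * \<bar>x - a\<bar> \<le> 1 * \<bar>x - a\<bar>"
          using s by (intro mult_right_mono) auto
        then have "q + s *\<^sub>R (a - x, 0) \<in> D"
          unfolding eq using s qD by (simp add: D_def abs_mult)
        then show "w (q + s *\<^sub>R (a - x, 0)) - v (q + s *\<^sub>R (a - x, 0)) \<le> w q - v q"
          by (rule q(2))
      qed simp
    next
      case False
      define T where "T = (UNIV :: real set) \<times> {- k<..<k}"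
      define S where "S = T \<inter> (\<lambda>q. r (snd q) - \<bar>fst q - a\<bar>) -` {0<..}"
      define c where "c y = sqrt (1 - (\<sigma> y)\<^sup>2)" for y
      define \<rho> where "\<rho> q = sqrt ((r (snd q))\<^sup>2 - (fst q - a)\<^sup>2)" for q :: "real \<times> real"
      define Gw where "Gw q = (1 / \<rho> q) *\<^sub>R (- (fst q - a), r (snd q) * (\<sigma> (snd q) / c (snd q)))" for q :: "real \<times> real"
      \<comment> \<open>The horizontal part of the unit normal in closed form. Its divergence is the
        derivative of \<open>\<sigma>\<close> minus \<open>c / r\<close>, that is
        \<open>2 * H'\<close> by the profile equation.\<close>
      define Z where "Z q = (- (fst q - a) * (c (snd q) / r (snd q)), \<sigma> (snd q))" for q :: "real \<times> real"
      have Tk: "T \<subseteq> UNIV \<times> {- k..k}"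
        by (auto simp: T_def)
      have "continuous_on T (\<lambda>q. r (snd q) - \<bar>fst q - a\<bar>)"
        by (intro continuous_intros continuous_on_compose2[OF cr]) (auto simp: T_def)
      moreover have "open T"
        by (simp add: T_def open_Times)
      ultimately have oS: "open S"
        unfolding S_def by (intro continuous_open_preimage) auto
      have qS: "q \<in> S"
        using False qD y by (auto simp: S_def T_def xy)
      have Smem: "snd z \<in> {- k<..<k}" "\<bar>fst z - a\<bar> < r (snd z)" if "z \<in> S" for z
        using that by (auto simp: S_def T_def)
      have SD: "z \<in> D" if "z \<in> S" for z
        using Smem[OF that] by (auto simp: D_def)
      have c: "0 < c y" "(c y)\<^sup>2 = 1 - (\<sigma> y)\<^sup>2" if "y \<in> {- k<..<k}" for y
      proof -
        have "(\<sigma> y)\<^sup>2 < 1"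
          using pr(2)[OF that] by (simp add: abs_square_less_1)
        then show "0 < c y" "(c y)\<^sup>2 = 1 - (\<sigma> y)\<^sup>2"
          by (auto simp: c_def)
      qed
      have pos: "0 < (r (snd z))\<^sup>2 - (fst z - a)\<^sup>2" if "z \<in> S" for z
        using power_strict_mono[OF Smem(2)[OF that], of 2] by simp
      have \<rho>: "0 < \<rho> z" "(\<rho> z)\<^sup>2 = (r (snd z))\<^sup>2 - (fst z - a)\<^sup>2" if "z \<in> S" for z
        using pos[OF that] by (auto simp: \<rho>_def)
      have dr: "((\<lambda>z. r (snd z)) has_derivative (\<lambda>e. \<sigma> (snd z) / c (snd z) * snd e)) (at z)"
        and ds: "((\<lambda>z. \<sigma> (snd z)) has_derivative (\<lambda>e. (2 * H' + c (snd z) / r (snd z)) * snd e)) (at z)" if "z \<in> S" for z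
        using has_derivative_compose[OF has_derivative_snd[OF has_derivative_ident] has_field_derivative_imp_has_derivative[OF pr(3)[OF Smem(1)[OF that]]]]
          has_derivative_compose[OF has_derivative_snd[OF has_derivative_ident] has_field_derivative_imp_has_derivative[OF pr(4)[OF Smem(1)[OF that]]]]
        unfolding c_def by simp_all
      have dsq: "((\<lambda>z. (r (snd z))\<^sup>2 - (fst z - a)\<^sup>2) has_derivative
          (\<lambda>e. 2 * (r (snd z) * (\<sigma> (snd z) / c (snd z) * snd e) - (fst z - a) * fst e))) (at z)" if "z \<in> S" for z
        by (rule derivative_eq_intros dr[OF that] refl)+ (simp add: algebra_simps)
      have d\<rho>: "(\<rho> has_derivative (\<lambda>e. 1 / (2 * \<rho> z) *
          (2 * (r (snd z) * (\<sigma> (snd z) / c (snd z) * snd e) - (fst z - a) * fst e)))) (at z)" if "z \<in> S" for z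
      proof -
        have "(sqrt has_real_derivative 1 / (2 * \<rho> z)) (at ((r (snd z))\<^sup>2 - (fst z - a)\<^sup>2))"
          using pos[OF that] unfolding \<rho>_def by (auto intro!: derivative_eq_intros simp: inverse_eq_divide)
        from has_derivative_compose[OF dsq[OF that] has_field_derivative_imp_has_derivative[OF this]]
        show ?thesis
          unfolding \<rho>_def[abs_def] .
      qed
      have gw: "GDERIV w z :> Gw z" if "z \<in> S" for z
      proof -
        have "(w has_derivative (\<lambda>e. 1 / (2 * \<rho> z) *
          (2 * (r (snd z) * (\<sigma> (snd z) / c (snd z) * snd e) - (fst z - a) * fst e)))) (at z)"
          using has_derivative_add[OF has_derivative_const[of b] d\<rho>[OF that]] unfolding w_def[abs_def] \<rho>_def[abs_def] by simp
        then show ?thesis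
          unfolding gderiv_def
          by (rule has_derivative_eq_rhs) (auto simp: fun_eq_iff Gw_def inner_prod_def add_divide_distrib diff_divide_distrib algebra_simps)
      qed
      have dc: "((\<lambda>z. c (snd z)) has_derivative (\<lambda>e. - (\<sigma> (snd q) / c (snd q)) * ((2 * H' + c (snd q) / r (snd q)) * snd e))) (at q)"
      proof -
        have "0 < 1 - (\<sigma> (snd q))\<^sup>2"
          using c[OF Smem(1)[OF qS]] by (metis zero_less_power)
        then have "((\<lambda>t. sqrt (1 - t\<^sup>2)) has_real_derivative - (\<sigma> (snd q) / c (snd q))) (at (\<sigma> (snd q)))"
          unfolding c_def by (auto intro!: derivative_eq_intros simp: inverse_eq_divide)
        from has_derivative_compose[OF ds[OF qS] has_field_derivative_imp_has_derivative[OF this]]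
        show ?thesis
          unfolding c_def .
      qed
      have nz: "\<rho> q \<noteq> 0" "c (snd q) \<noteq> 0" "r (snd q) \<noteq> 0"
        using \<rho>(1)[OF qS] c(1)[OF Smem(1)[OF qS]] pr(1)[OF Smem(1)[OF qS]] by auto
      have "\<exists>Bw. (Gw has_derivative Bw) (at q)"
        unfolding Gw_def[abs_def]
        by (rule exI) (rule derivative_intros d\<rho>[OF qS] dr[OF qS] ds[OF qS] dc nz has_derivative_divide)+
      then obtain Bw where Bw: "(Gw has_derivative Bw) (at q)" ..
      have nm: "nmap (Gw z) = Z z" if z: "z \<in> S" for z
      proof -
        let ?y = "snd z"
        note cy = c[OF Smem(1)[OF z]] and ry = pr(1)[OF Smem(1)[OF z]] and rz = \<rho>[OF z]
        have "(norm (Gw z))\<^sup>2 = ((fst z - a)\<^sup>2 + (r ?y)\<^sup>2 * ((\<sigma> ?y)\<^sup>2 / (c ?y)\<^sup>2)) / (\<rho> z)\<^sup>2"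
          by (simp add: Gw_def norm_Pair power_divide power_mult_distrib add_divide_distrib
              mult.commute power2_commute[of a])
        also have "1 + \<dots> = ((\<rho> z)\<^sup>2 + (fst z - a)\<^sup>2 + (r ?y)\<^sup>2 * ((\<sigma> ?y)\<^sup>2 / (c ?y)\<^sup>2)) / (\<rho> z)\<^sup>2"
          using rz(1) by (simp add: field_simps)
        also have "(\<rho> z)\<^sup>2 + (fst z - a)\<^sup>2 + (r ?y)\<^sup>2 * ((\<sigma> ?y)\<^sup>2 / (c ?y)\<^sup>2)
          = (r ?y)\<^sup>2 * ((c ?y)\<^sup>2 + (\<sigma> ?y)\<^sup>2) / (c ?y)\<^sup>2"
          using rz(2) cy(1) by (simp add: field_simps)
        also have "(c ?y)\<^sup>2 + (\<sigma> ?y)\<^sup>2 = 1"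
          using cy(2) by simp
        finally have "1 + (norm (Gw z))\<^sup>2 = (r ?y / (c ?y * \<rho> z))\<^sup>2"
          by (simp add: power_divide power_mult_distrib)
        then have "sqrt (1 + (norm (Gw z))\<^sup>2) = r ?y / (c ?y * \<rho> z)"
          using ry cy(1) rz(1) by simp
        then have "nmap (Gw z) = (c ?y * \<rho> z / r ?y) *\<^sub>R Gw z"
          by (simp add: nmap_def)
        then show ?thesis
          using ry cy(1) rz(1) by (simp add: Gw_def Z_def field_simps)
      qed
      \<comment> \<open>Only the form of this derivative matters: \<open>E\<close> enters a mixed
        derivative of \<open>Z\<close>, not its divergence.\<close>
      obtain E where E: "((\<lambda>z. c (snd z) / r (snd z)) has_derivative (\<lambda>e. E * snd e)) (at q)"
      proof -
        have "((\<lambda>z. c (snd z) / r (snd z)) has_derivative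
           (\<lambda>e. ((- (\<sigma> (snd q) / c (snd q)) * (2 * H' + c (snd q) / r (snd q))) * r (snd q)
              - c (snd q) * (\<sigma> (snd q) / c (snd q))) / (r (snd q) * r (snd q)) * snd e)) (at q)"
          by (rule has_derivative_eq_rhs[OF has_derivative_divide'[OF dc dr[OF qS] nz(3)]])
            (simp add: fun_eq_iff algebra_simps)
        then show thesis
          using that by blast
      qed
      have "(Z has_derivative (\<lambda>e. (- (fst q - a) * (E * snd e) - fst e * (c (snd q) / r (snd q)),
          (2 * H' + c (snd q) / r (snd q)) * snd e))) (at q)"
        unfolding Z_def[abs_def]
        by (rule has_derivative_Pair[OF _ ds[OF qS]], rule has_derivative_eq_rhs[OF has_derivative_mult[OF _ E]])
          (auto intro!: derivative_eq_intros)
      from graph_div_field[OF oS qS nm Bw this]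
      have "graph_div (Gw q) Bw = 2 * H'"
        unfolding sum_Basis_real_prod by simp
      moreover have "graph_div (Gw q) Bw \<le> graph_div (G q) (B q)"
      proof (rule graph_div_touching[OF oS qS gw _ Bw])
        show "(G has_derivative B q) (at q)"
          using gv qO by (simp add: graph_on_def)
        show "GDERIV v z :> G z" if "z \<in> S" for z
          using gv SD[OF that] D\<Omega> by (auto simp: graph_on_def)
        show "w z - v z \<le> w q - v q" if "z \<in> S" for z
          using q(2)[OF SD[OF that]] .
      qed
      ultimately show False
        using div[OF qO] H by simp
    qed
  qed
  then have "w q \<le> v q"
    using bd[of y x] qD by (simp add: w_def xy)
  then show ?thesis
    using q(2)[OF pD] by (simp add: w_def)
qed

section \<open>The nodoid\<close>

locale nodoid =
  fixes H t \<rho> :: real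
  assumes H: "0 < H" and t: "0 < t" and \<rho>_def: "\<rho> = rho t H"
begin

lemma \<rho>: "0 < \<rho>" "H * \<rho>\<^sup>2 = H * t\<^sup>2 + t"
proof -
  have "0 < (H * t\<^sup>2 + t) / H"
    using H t by (intro divide_pos_pos add_nonneg_pos) auto
  then have "0 < \<rho>" "\<rho>\<^sup>2 = (H * t\<^sup>2 + t) / H"
    by (simp_all add: \<rho>_def rho_def)
  then show "0 < \<rho>" "H * \<rho>\<^sup>2 = H * t\<^sup>2 + t"
    using H by simp_all
qed

text \<open>
  Taking the sine of the slope angle as parameter removes the singularity of the integrand of the
  half-width at the neck.
\<close>

definition rad :: "real \<Rightarrow> real" where
  "rad \<sigma> = (sqrt ((sqrt (1 - \<sigma>\<^sup>2))\<^sup>2 + 4 * H\<^sup>2 * \<rho>\<^sup>2) - sqrt (1 - \<sigma>\<^sup>2)) / (2 * H)"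

text \<open>The derivative of the position along the axis with respect to \<open>\<sigma>\<close>,
  that is, the reciprocal of the right-hand side of the profile equation for
  \<open>\<sigma>\<close>.\<close>

definition dens :: "real \<Rightarrow> real" where "dens \<sigma> = (rad \<sigma>)\<^sup>2 / (H * ((rad \<sigma>)\<^sup>2 + \<rho>\<^sup>2))"

text \<open>The position along the axis, normalised to 0 at the neck. Integration starts at
  \<open>-2\<close> so that the function is differentiable at \<open>-1\<close> and \<open>1\<close>
  as well.\<close>

definition axis :: "real \<Rightarrow> real" where "axis x = integral {-2..x} dens - integral {-2..0} dens"

text \<open>Valid for every real \<open>\<sigma>\<close>: if \<open>|\<sigma>| > 1\<close> then
  \<open>sqrt (1 - \<sigma>^2)\<close> is negative, but \<open>rad\<close> contains its square in
  place of \<open>1 - \<sigma>^2\<close>, so the outer radicand stays positive.\<close>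

lemma rad_pos: "0 < rad \<sigma>"
proof -
  have "0 < 4 * H\<^sup>2 * \<rho>\<^sup>2"
    using H \<rho> by simp
  then have "sqrt (1 - \<sigma>\<^sup>2) < sqrt ((sqrt (1 - \<sigma>\<^sup>2))\<^sup>2 + 4 * H\<^sup>2 * \<rho>\<^sup>2)"
    by (intro real_less_rsqrt) simp
  then show ?thesis
    using H by (simp add: rad_def)
qed

lemma rad_sqrt: "sqrt ((sqrt (1 - \<sigma>\<^sup>2))\<^sup>2 + 4 * H\<^sup>2 * \<rho>\<^sup>2) = 2 * H * rad \<sigma> + sqrt (1 - \<sigma>\<^sup>2)"
  using H by (simp add: rad_def)

text \<open>The first integral of the profile equations, of which \<open>rad\<close> is the positive
  root. It gives radius \<open>t\<close> at the neck \<open>\<sigma> = 0\<close> and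
  \<open>\<rho>\<close> at \<open>|\<sigma>| = 1\<close>.\<close>

lemma rad_eq: "H * (\<rho>\<^sup>2 - (rad \<sigma>)\<^sup>2) = rad \<sigma> * sqrt (1 - \<sigma>\<^sup>2)"
proof -
  have "(2 * H * rad \<sigma> + sqrt (1 - \<sigma>\<^sup>2))\<^sup>2 = (sqrt (1 - \<sigma>\<^sup>2))\<^sup>2 + 4 * H\<^sup>2 * \<rho>\<^sup>2"
    unfolding rad_sqrt[symmetric] by simp
  then have "4 * H * (H * (\<rho>\<^sup>2 - (rad \<sigma>)\<^sup>2)) = 4 * H * (rad \<sigma> * sqrt (1 - \<sigma>\<^sup>2))"
    by (simp add: power2_eq_square algebra_simps)
  then show ?thesis
    using H by simp
qed

lemma rad_unique:
  assumes "0 < x" "H * (\<rho>\<^sup>2 - x\<^sup>2) = x * sqrt (1 - \<sigma>\<^sup>2)"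
  shows "rad \<sigma> = x"
proof -
  have "(sqrt (1 - \<sigma>\<^sup>2))\<^sup>2 + 4 * H\<^sup>2 * \<rho>\<^sup>2 = (2 * H * x + sqrt (1 - \<sigma>\<^sup>2))\<^sup>2"
  proof -
    have "4 * H\<^sup>2 * \<rho>\<^sup>2 - 4 * H\<^sup>2 * x\<^sup>2 = 4 * H * (H * (\<rho>\<^sup>2 - x\<^sup>2))"
      by (simp add: power2_eq_square algebra_simps)
    also have "\<dots> = 4 * H * (x * sqrt (1 - \<sigma>\<^sup>2))"
      by (simp only: assms(2))
    finally show ?thesis
      by (simp add: power2_sum power_mult_distrib mult_ac)
  qed
  moreover have "0 \<le> 2 * H * x + sqrt (1 - \<sigma>\<^sup>2)"
  proof -
    have "sqrt (1 - \<sigma>\<^sup>2) = H * (\<rho>\<^sup>2 - x\<^sup>2) / x"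
      using assms by simp
    then have "2 * H * x + sqrt (1 - \<sigma>\<^sup>2) = H * (\<rho>\<^sup>2 + x\<^sup>2) / x"
      using assms(1) by (simp add: field_simps power2_eq_square)
    then show ?thesis
      using assms(1) H by simp
  qed
  ultimately show ?thesis
    unfolding rad_def using H by simp
qed

lemma rad_le:
  assumes "\<bar>\<sigma>\<bar> \<le> 1"
  shows "rad \<sigma> \<le> \<rho>" "t \<le> rad \<sigma>"
proof -
  have "0 \<le> sqrt (1 - \<sigma>\<^sup>2)" "sqrt (1 - \<sigma>\<^sup>2) \<le> 1"
    using assms by (auto simp: abs_square_le_1)
  then have 1: "0 \<le> rad \<sigma> * sqrt (1 - \<sigma>\<^sup>2)" "rad \<sigma> * sqrt (1 - \<sigma>\<^sup>2) \<le> rad \<sigma>"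
    using rad_pos[of \<sigma>] by (auto intro: mult_left_le)
  then have "(rad \<sigma>)\<^sup>2 \<le> \<rho>\<^sup>2"
    unfolding rad_eq[symmetric] using H by (simp add: zero_le_mult_iff)
  then show "rad \<sigma> \<le> \<rho>"
    by (rule power2_le_imp_le) (use \<rho>(1) in simp)
  show "t \<le> rad \<sigma>"
  proof (rule ccontr)
    assume "\<not> t \<le> rad \<sigma>"
    then have lt: "rad \<sigma> < t"
      by simp
    then have "H * (rad \<sigma>)\<^sup>2 \<le> H * t\<^sup>2"
      using H rad_pos[of \<sigma>] by (intro mult_left_mono power_mono) auto
    moreover have "H * \<rho>\<^sup>2 - H * (rad \<sigma>)\<^sup>2 \<le> rad \<sigma>"
      using 1(2) unfolding rad_eq[symmetric] by (simp add: right_diff_distrib)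
    ultimately show False
      using lt \<rho>(2) by linarith
  qed
qed

lemma rad_one: "\<bar>\<sigma>\<bar> = 1 \<Longrightarrow> rad \<sigma> = \<rho>"
proof (rule rad_unique)
  assume "\<bar>\<sigma>\<bar> = 1"
  then have "\<sigma>\<^sup>2 = 1"
    by (metis power2_abs power_one)
  then show "H * (\<rho>\<^sup>2 - \<rho>\<^sup>2) = \<rho> * sqrt (1 - \<sigma>\<^sup>2)"
    by simp
qed (rule \<rho>)

lemma continuous_on_rad: "continuous_on S rad"
  unfolding rad_def[abs_def] using H by (intro continuous_intros) auto

lemma dens_den: "H * ((rad \<sigma>)\<^sup>2 + \<rho>\<^sup>2) > 0"
  using H rad_pos[of \<sigma>] by (intro mult_pos_pos add_pos_nonneg) auto

lemma continuous_on_dens: "continuous_on S dens"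
  unfolding dens_def[abs_def] using dens_den
  by (intro continuous_intros continuous_on_rad ballI) (metis less_irrefl)

lemma dens_pos: "0 < dens \<sigma>"
  unfolding dens_def using dens_den rad_pos[of \<sigma>] by (intro divide_pos_pos) auto

lemma dens_le: "\<bar>\<sigma>\<bar> \<le> 1 \<Longrightarrow> dens \<sigma> \<le> 1 / (2 * H)"
proof -
  assume "\<bar>\<sigma>\<bar> \<le> 1"
  then have "(rad \<sigma>)\<^sup>2 \<le> \<rho>\<^sup>2"
    using rad_le(1) rad_pos[of \<sigma>] by (intro power_mono) auto
  then show ?thesis
    unfolding dens_def using H dens_den[of \<sigma>]
    by (simp add: divide_le_eq mult.commute)
qed

lemma dens_inverse: "inverse (dens \<sigma>) = 2 * H + sqrt (1 - \<sigma>\<^sup>2) / rad \<sigma>"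
proof -
  have "H * ((rad \<sigma>)\<^sup>2 + \<rho>\<^sup>2) = rad \<sigma> * (2 * H * rad \<sigma> + sqrt (1 - \<sigma>\<^sup>2))"
    using rad_eq[of \<sigma>] by (simp add: power2_eq_square algebra_simps)
  then show ?thesis
    unfolding dens_def using rad_pos[of \<sigma>]
    by (simp add: field_simps power2_eq_square)
qed

lemma DERIV_axis:
  assumes "x \<in> {-2<..<2}"
  shows "(axis has_real_derivative dens x) (at x)"
proof -
  have "((\<lambda>x. integral {-2..x} dens) has_real_derivative dens x) (at x within {-2..2})"
    using assms by (intro integral_has_real_derivative continuous_on_dens) auto
  then have "((\<lambda>x. integral {-2..x} dens) has_real_derivative dens x) (at x)"
    using assms by (simp add: at_within_Icc_at)
  then show ?thesis
    unfolding axis_def[abs_def] by (auto intro!: derivative_eq_intros)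
qed

lemma continuous_on_axis: "continuous_on {-1..1} axis"
  by (intro continuous_at_imp_continuous_on ballI DERIV_isCont[OF DERIV_axis]) auto

lemma axis_less: "-1 \<le> x \<Longrightarrow> x < y \<Longrightarrow> y \<le> 1 \<Longrightarrow> axis x < axis y"
  by (rule DERIV_pos_imp_increasing[of x y axis], assumption, rule exI[of _ "dens _"])
    (auto intro!: DERIV_axis dens_pos)

text \<open>Symmetry of the nodoid about its neck: \<open>dens\<close> is even.\<close>

lemma axis_minus:
  assumes "\<bar>x\<bar> \<le> 1"
  shows "axis (- x) = - axis x"
proof -
  have der: "((\<lambda>x. axis x + axis (- x)) has_real_derivative 0) (at x within {-1..1})" if x: "x \<in> {-1..1}" for x
  proof -
    have x2: "x \<in> {-2<..<2}" "- x \<in> {-2<..<2}"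
      using x by auto
    have "((\<lambda>x. axis (- x)) has_real_derivative dens (- x) * (- 1)) (at x)"
      by (rule DERIV_chain2[where f = axis and g = uminus, OF DERIV_axis[OF x2(2)]]) (auto intro!: derivative_eq_intros)
    moreover have "dens (- x) = dens x"
      by (simp add: dens_def rad_def)
    ultimately have "((\<lambda>x. axis x + axis (- x)) has_real_derivative 0) (at x)"
      using DERIV_add[OF DERIV_axis[OF x2(1)]] by fastforce
    then show ?thesis
      by (rule has_field_derivative_at_within)
  qed
  obtain c where c: "\<And>x. x \<in> {-1..1} \<Longrightarrow> axis x + axis (- x) = c"
    using has_field_derivative_zero_constant[OF _ der] by (metis convex_real_interval(5))
  have "axis 0 = 0"
    by (simp add: axis_def)
  then have "c = 0"
    using c[of 0] by simp
  moreover have "x \<in> {-1..1}"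
    using assms unfolding atLeastAtMost_iff by linarith
  ultimately show ?thesis
    using c[of x] by simp
qed

text \<open>The substitution \<open>x = rad \<sigma>\<close>. Here \<open>c x\<close> and
  \<open>s x\<close> are the cosine and sine of the slope angle at radius \<open>x\<close>, and the
  integrand is \<open>c x / s x\<close>, the derivative of \<open>axis (s x)\<close>. This
  derivative is taken in the open interval only, so the zero of \<open>s\<close> at \<open>t\<close>
  does no harm.\<close>

lemma half_width_eq: "half_width t H = axis 1"
proof -
  define c where "c x = H * (\<rho>\<^sup>2 - x\<^sup>2) / x" for x
  define s where "s x = sqrt (1 - (c x)\<^sup>2)" for x
  have t\<rho>: "t < \<rho>"
  proof -
    have "H * t\<^sup>2 < H * \<rho>\<^sup>2"
      using \<rho>(2) t by simp
    then show ?thesis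
      using H \<rho>(1) by (simp add: power2_less_imp_less)
  qed
  have c01: "0 \<le> c x" "c x \<le> 1" if "x \<in> {t..\<rho>}" for x
  proof -
    have x: "0 < x" "t \<le> x" "x \<le> \<rho>"
      using that t by auto
    have "x\<^sup>2 \<le> \<rho>\<^sup>2" "t\<^sup>2 \<le> x\<^sup>2"
      using x t by (auto intro: power_mono)
    then have "0 \<le> H * (\<rho>\<^sup>2 - x\<^sup>2)" "H * t\<^sup>2 \<le> H * x\<^sup>2"
      using H by auto
    then show "0 \<le> c x" "c x \<le> 1"
      unfolding c_def using x \<rho>(2) by (auto simp: field_simps)
  qed
  have c01': "0 < c x" "c x < 1" if "x \<in> {t<..<\<rho>}" for x
  proof -
    have x: "0 < x" "t < x" "x < \<rho>"
      using that t by auto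
    have "x\<^sup>2 < \<rho>\<^sup>2" "t\<^sup>2 < x\<^sup>2"
      using x t by (auto intro: power_strict_mono)
    then have "0 < H * (\<rho>\<^sup>2 - x\<^sup>2)" "H * t\<^sup>2 < H * x\<^sup>2"
      using H by auto
    then show "0 < c x" "c x < 1"
      unfolding c_def using x \<rho>(2) by (auto simp: field_simps)
  qed
  have s01: "0 \<le> s x" "s x \<le> 1" if "x \<in> {t..\<rho>}" for x
    using c01[OF that] by (auto simp: s_def power_le_one)
  have rs: "sqrt (1 - (s x)\<^sup>2) = c x" "rad (s x) = x" if "x \<in> {t..\<rho>}" for x
  proof -
    have "(c x)\<^sup>2 \<le> 1"
      using c01[OF that] by (simp add: power_le_one)
    then show 1: "sqrt (1 - (s x)\<^sup>2) = c x"
      using c01[OF that] by (simp add: s_def)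
    show "rad (s x) = x"
      by (rule rad_unique) (use that t in \<open>auto simp: 1 c_def\<close>)
  qed
  have "((\<lambda>x. H * (\<rho>\<^sup>2 - x\<^sup>2) / sqrt (x\<^sup>2 - H\<^sup>2 * (\<rho>\<^sup>2 - x\<^sup>2)\<^sup>2)) has_integral axis (s \<rho>) - axis (s t)) {t..\<rho>}"
  proof (rule fundamental_theorem_of_calculus_interior)
    have "continuous_on {t..\<rho>} s"
      unfolding s_def[abs_def] c_def using t by (intro continuous_intros) auto
    then show "continuous_on {t..\<rho>} (\<lambda>x. axis (s x))"
      by (rule continuous_on_compose2[OF continuous_on_axis]) (use s01 in fastforce)
    fix x assume x: "x \<in> {t<..<\<rho>}"
    then have xI: "x \<in> {t..\<rho>}" and x0: "0 < x"
      using t by auto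
    have c1: "(c x)\<^sup>2 < 1"
      using c01'[OF x] by (simp add: power_less_one_iff)
    then have sx: "0 < s x"
      by (simp add: s_def)
    have dc: "(c has_real_derivative - (H * (\<rho>\<^sup>2 + x\<^sup>2) / x\<^sup>2)) (at x)"
      unfolding c_def[abs_def] using x0
      by (auto intro!: derivative_eq_intros simp: field_simps power2_eq_square)
    have "((\<lambda>z. sqrt (1 - z\<^sup>2)) has_real_derivative - (c x / s x)) (at (c x))"
      using c1 unfolding s_def by (auto intro!: derivative_eq_intros simp: inverse_eq_divide)
    from DERIV_chain2[OF this dc]
    have ds: "(s has_real_derivative - (c x / s x) * - (H * (\<rho>\<^sup>2 + x\<^sup>2) / x\<^sup>2)) (at x)"
      unfolding s_def[abs_def] .
    have "s x \<in> {-2<..<2}"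
      using s01[OF xI] by auto
    from DERIV_chain2[OF DERIV_axis[OF this] ds]
    have "((\<lambda>x. axis (s x)) has_real_derivative dens (s x) * (- (c x / s x) * - (H * (\<rho>\<^sup>2 + x\<^sup>2) / x\<^sup>2))) (at x)" .
    moreover have "dens (s x) * (- (c x / s x) * - (H * (\<rho>\<^sup>2 + x\<^sup>2) / x\<^sup>2)) = c x / s x"
    proof -
      have "dens (s x) = x\<^sup>2 / (H * (\<rho>\<^sup>2 + x\<^sup>2))"
        by (simp add: dens_def rs(2)[OF xI] add.commute)
      moreover have "H * (\<rho>\<^sup>2 + x\<^sup>2) \<noteq> 0"
        using H x0 by (simp add: add_nonneg_eq_0_iff)
      ultimately show ?thesis
        using x0 by simp
    qed
    moreover have "c x / s x = H * (\<rho>\<^sup>2 - x\<^sup>2) / sqrt (x\<^sup>2 - H\<^sup>2 * (\<rho>\<^sup>2 - x\<^sup>2)\<^sup>2)"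
    proof -
      have "H\<^sup>2 * (\<rho>\<^sup>2 - x\<^sup>2)\<^sup>2 = (x * c x)\<^sup>2"
        unfolding power_mult_distrib[symmetric] using x0 by (simp add: c_def)
      then have "x\<^sup>2 - H\<^sup>2 * (\<rho>\<^sup>2 - x\<^sup>2)\<^sup>2 = x\<^sup>2 * (1 - (c x)\<^sup>2)"
        by (simp add: power_mult_distrib right_diff_distrib)
      then have "sqrt (x\<^sup>2 - H\<^sup>2 * (\<rho>\<^sup>2 - x\<^sup>2)\<^sup>2) = x * s x"
        using x0 by (simp add: real_sqrt_mult s_def)
      then show ?thesis
        by (simp add: c_def)
    qed
    ultimately show "((\<lambda>x. axis (s x)) has_vector_derivative
        H * (\<rho>\<^sup>2 - x\<^sup>2) / sqrt (x\<^sup>2 - H\<^sup>2 * (\<rho>\<^sup>2 - x\<^sup>2)\<^sup>2)) (at x)"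
      by (simp add: has_real_derivative_iff_has_vector_derivative)
  qed (use t\<rho> in simp)
  moreover have "c t = 1" "c \<rho> = 0"
    using \<rho>(2) t by (simp_all add: c_def right_diff_distrib)
  then have "s t = 0" "s \<rho> = 1"
    by (simp_all add: s_def)
  moreover have "axis 0 = 0"
    by (simp add: axis_def)
  ultimately show ?thesis
    unfolding half_width_def \<rho>_def[symmetric] by (simp add: integral_unique)
qed

lemma half_width_bounds: "0 < half_width t H" "half_width t H \<le> 1 / (2 * H)"
proof -
  have "axis 0 = 0"
    by (simp add: axis_def)
  then show "0 < half_width t H"
    using axis_less[of 0 1] by (simp add: half_width_eq)
  obtain z where z: "0 < z" "z < 1" "axis 1 - axis 0 = (1 - 0) * dens z"
    using MVT2[of 0 1 axis dens] DERIV_axis by fastforce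
  then show "half_width t H \<le> 1 / (2 * H)"
    using dens_le[of z] \<open>axis 0 = 0\<close> by (simp add: half_width_eq)
qed

text \<open>Take \<open>\<sigma>\<close> as the inverse of \<open>axis\<close> and \<open>r\<close>
  as \<open>rad\<close> of it. The inverse function rule with \<open>dens_inverse\<close> gives the
  equation for \<open>\<sigma>\<close>; the chain rule then gives the one for
  \<open>r\<close>.\<close>

lemma profile_exists:
  obtains r \<sigma> where "nodoid_profile (half_width t H) H r \<sigma>"
    and "r (half_width t H) = \<rho>" "r (- half_width t H) = \<rho>"
    and "\<And>y. y \<in> {- half_width t H..half_width t H} \<Longrightarrow> t \<le> r y"
proof -
  define h where "h = half_width t H"
  define \<sigma> where "\<sigma> = inv_into {-1..1} axis"
  define r where "r y = rad (\<sigma> y)" for y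
  have hp: "axis 1 = h" "axis (- 1) = - h"
    using axis_minus[of 1] by (simp_all add: h_def half_width_eq)
  have inj: "inj_on axis {-1..1}"
    by (rule linorder_inj_onI') (use axis_less in fastforce)
  have img: "axis ` {-1..1} = {- h..h}"
  proof
    have "axis (-1) \<le> axis x \<and> axis x \<le> axis 1" if "x \<in> {-1..1}" for x
      using axis_less[of "-1" x] axis_less[of x 1] that by (cases "x = -1"; cases "x = 1") auto
    then show "axis ` {-1..1} \<subseteq> {- h..h}"
      using hp by auto
    have "\<exists>x\<ge>-1. x \<le> 1 \<and> axis x = y" if "y \<in> {- h..h}" for y
      using that hp by (intro IVT' continuous_on_axis) auto
    then show "{- h..h} \<subseteq> axis ` {-1..1}"
      by fastforce
  qed
  have inv: "\<sigma> y \<in> {-1..1}" "axis (\<sigma> y) = y" if "y \<in> {- h..h}" for y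
    unfolding \<sigma>_def using that img inv_into_into[of y axis "{-1..1}"] f_inv_into_f[of y axis "{-1..1}"] by auto
  have inv': "\<sigma> (axis x) = x" if "x \<in> {-1..1}" for x
    unfolding \<sigma>_def using inv_into_f_f[OF inj that] .
  have c\<sigma>: "continuous_on {- h..h} \<sigma>"
    using continuous_on_inv[of "{-1..1}" axis \<sigma>] continuous_on_axis inv' img by auto
  have \<sigma>1: "\<sigma> h = 1" "\<sigma> (- h) = - 1"
    using inv'[of 1] inv'[of "- 1"] hp by auto
  have "nodoid_profile h H r \<sigma>"
    unfolding nodoid_profile_def
  proof (intro conjI ballI)
    show "continuous_on {- h..h} r"
      unfolding r_def[abs_def] by (rule continuous_on_compose2[OF continuous_on_rad c\<sigma> subset_refl])
    fix y assume y: "y \<in> {- h<..<h}"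
    then have y': "y \<in> {- h..h}"
      by auto
    show "0 < r y"
      by (simp add: r_def rad_pos)
    have "\<sigma> y \<noteq> 1" "\<sigma> y \<noteq> -1"
      using inv(2)[OF y'] hp y by auto
    then show s1: "\<bar>\<sigma> y\<bar> < 1"
      using inv(1)[OF y'] by auto
    have d1: "(axis has_real_derivative dens (\<sigma> y)) (at (\<sigma> y))"
      using s1 by (intro DERIV_axis) auto
    have ct: "isCont \<sigma> y"
      using continuous_on_interior[OF c\<sigma>] y by simp
    have "(\<sigma> has_real_derivative inverse (dens (\<sigma> y))) (at y)"
    proof (rule DERIV_inverse_function[where f = axis and g = \<sigma>, OF d1 _ _ _ _ ct])
      show "dens (\<sigma> y) \<noteq> 0"
        using dens_pos[of "\<sigma> y"] by simp
      show "- h < y" "y < h"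
        using y by auto
      show "axis (\<sigma> z) = z" if "- h < z" "z < h" for z
        using that by (intro inv(2)) auto
    qed
    then show ds: "(\<sigma> has_real_derivative 2 * H + sqrt (1 - (\<sigma> y)\<^sup>2) / r y) (at y)"
      by (simp add: dens_inverse r_def)
    define z where "z = \<sigma> y"
    define c where "c = sqrt (1 - z\<^sup>2)"
    define S where "S = 2 * H * rad z + c"
    have z1: "z\<^sup>2 < 1"
      using s1 by (simp add: z_def abs_square_less_1)
    then have c: "0 < c"
      by (simp add: c_def)
    then have S: "0 < S"
      using H rad_pos[of z] by (simp add: S_def add_pos_pos)
    have S': "S = sqrt (c\<^sup>2 + 4 * H\<^sup>2 * \<rho>\<^sup>2)"
      unfolding S_def c_def rad_sqrt ..
    have dc: "((\<lambda>z. sqrt (1 - z\<^sup>2)) has_real_derivative - (z / c)) (at z)"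
      using z1 unfolding c_def by (auto intro!: derivative_eq_intros simp: inverse_eq_divide)
    have "0 < c\<^sup>2 + 4 * H\<^sup>2 * \<rho>\<^sup>2"
      using c by (intro add_pos_nonneg) auto
    then have "((\<lambda>c. (sqrt (c\<^sup>2 + 4 * H\<^sup>2 * \<rho>\<^sup>2) - c) / (2 * H)) has_real_derivative (c / S - 1) / (2 * H)) (at c)"
      unfolding S' using H by (auto intro!: derivative_eq_intros simp: inverse_eq_divide diff_divide_distrib)
    from DERIV_chain2[OF this[unfolded c_def] dc]
    have "(rad has_real_derivative (c / S - 1) / (2 * H) * - (z / c)) (at z)"
      unfolding rad_def[abs_def] c_def .
    moreover have "(c / S - 1) / (2 * H) * - (z / c) = rad z / S * (z / c)"
    proof -
      have "c / S - 1 = - (2 * H * rad z / S)"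
        using S by (simp add: S_def field_simps)
      then show ?thesis
        using H by simp
    qed
    ultimately have "(rad has_real_derivative rad z / S * (z / c)) (at z)"
      by simp
    from DERIV_chain2[OF this[unfolded z_def] ds]
    have "(r has_real_derivative rad z / S * (z / c) * (2 * H + c / rad z)) (at y)"
      unfolding r_def[abs_def] z_def[symmetric] c_def[symmetric] .
    moreover have "2 * H + c / rad z = S / rad z"
      using rad_pos[of z] by (simp add: S_def field_simps)
    ultimately show "(r has_real_derivative \<sigma> y / sqrt (1 - (\<sigma> y)\<^sup>2)) (at y)"
      using S rad_pos[of z] by (simp add: z_def[symmetric] c_def[symmetric])
  qed
  moreover have "r h = \<rho>" "r (- h) = \<rho>"
    using rad_one by (simp_all add: r_def \<sigma>1)
  moreover have "t \<le> r y" if "y \<in> {- h..h}" for y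
    unfolding r_def using inv(1)[OF that] by (intro rad_le) auto
  ultimately show thesis
    using that unfolding h_def by blast
qed

end

section \<open>Comparison at the ends of the strip\<close>

text \<open>
  Comparison with the nodoid over the exterior disc. Its mean curvature is exactly \<open>H\<close>; shrinking
  it by a factor below 1 makes it a strict subsolution, and the limit gives the bound.
\<close>

lemma lower_barrier:
  fixes v :: "real \<times> real \<Rightarrow> real"
  assumes H: "0 < H" and t: "0 < t" and h: "h = half_width t H"
    and \<Omega>: "\<Omega> = UNIV \<times> {- h<..<h}" and cv: "continuous_on (closure \<Omega>) v"
    and gv: "graph_on \<Omega> v G B" and div: "\<And>p. p \<in> \<Omega> \<Longrightarrow> graph_div (G p) (B p) = 2 * H"
    and vf: "\<And>x y. \<bar>y\<bar> = h \<Longrightarrow> v (x, y) = f x"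
    and disc: "\<And>x. \<bar>x - a\<bar> \<le> rho t H \<Longrightarrow> b + sqrt ((rho t H)\<^sup>2 - (x - a)\<^sup>2) \<le> f x"
    and p: "(x0, y0) \<in> \<Omega>" "\<bar>x0 - a\<bar> < t"
  shows "b \<le> v (x0, y0)"
proof (rule field_le_epsilon)
  fix e :: real assume e: "0 < e"
  interpret nodoid H t "rho t H"
    by unfold_locales (use H t in auto)
  let ?\<rho> = "rho t H"
  have h0: "0 < h"
    using half_width_bounds by (simp add: h)
  obtain r \<sigma> where P: "nodoid_profile h H r \<sigma>" and rh: "r h = ?\<rho>" "r (- h) = ?\<rho>"
    and rt: "\<And>y. y \<in> {- h..h} \<Longrightarrow> t \<le> r y"
    using profile_exists unfolding h by blast
  have cl: "closure \<Omega> = UNIV \<times> {- h..h}"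
    unfolding \<Omega> using h0 by (simp add: closure_Times)
  define K where "K = {a - ?\<rho>..a + ?\<rho>} \<times> {- h..h}"
  have "uniformly_continuous_on K v"
    unfolding K_def by (intro compact_uniformly_continuous continuous_on_subset[OF cv] compact_Times) (auto simp: cl)
  then obtain \<delta> where \<delta>: "0 < \<delta>" "\<And>p q. p \<in> K \<Longrightarrow> q \<in> K \<Longrightarrow> dist q p < \<delta> \<Longrightarrow> dist (v q) (v p) < e"
    unfolding uniformly_continuous_on_def using e by metis
  \<comment> \<open>Any ratio \<open>l\<close> strictly between \<open>m\<close> and 1 keeps the
    point below the shrunken nodoid and the ends of that nodoid within \<open>\<delta>\<close> of
    the edges.\<close>
  define m where "m = max (max (\<bar>y0\<bar> / h) (\<bar>x0 - a\<bar> / t)) (1 - \<delta> / h)"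
  define l where "l = (1 + m) / 2"
  have "\<bar>y0\<bar> < h"
    using p(1) by (auto simp: \<Omega>)
  then have m: "0 \<le> m" "m < 1" "\<bar>y0\<bar> / h \<le> m" "\<bar>x0 - a\<bar> / t \<le> m" "1 - \<delta> / h \<le> m"
    using h0 t p(2) \<delta>(1) by (auto simp: m_def le_max_iff_disj)
  have l: "0 < l" "l < 1" "m < l"
    using m by (auto simp: l_def)
  have mh: "m * h < l * h" "m * t < l * t"
    using l(3) h0 t by auto
  have ly: "\<bar>y0\<bar> < l * h"
    using m(3) mh(1) unfolding pos_divide_le_eq[OF h0] by linarith
  have lx: "\<bar>x0 - a\<bar> < l * t"
    using m(4) mh(2) unfolding pos_divide_le_eq[OF t] by linarith
  have "(1 - \<delta> / h) * h \<le> m * h"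
    using m(5) h0 by (intro mult_right_mono) auto
  then have "h - \<delta> \<le> m * h"
    using h0 by (simp add: left_diff_distrib)
  then have l\<delta>: "h - l * h < \<delta>"
    using mh(1) by linarith
  have "b - e + sqrt ((l * r (y0 / l))\<^sup>2 - (x0 - a)\<^sup>2) \<le> v (x0, y0)"
  proof (rule nodoid_barrier_strict[OF nodoid_profile_scale[OF P l(1)] _ _ _ _ _ \<Omega> gv div])
    show "H < H / l" "0 < l * h" "l * h < h"
      using H l h0 by (auto simp: field_simps)
    show "0 \<le> l * r (l * h / l)" "0 \<le> l * r (- (l * h) / l)"
      using l rh \<rho>(1) by auto
    show "\<bar>y0\<bar> \<le> l * h"
      using ly by simp
    have "y0 / l \<in> {- h..h}"
      using ly l by (auto simp: field_simps abs_less_iff)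
    then have "l * t \<le> l * r (y0 / l)"
      using rt l by simp
    then show "\<bar>x0 - a\<bar> \<le> l * r (y0 / l)"
      using lx by simp
    fix x y assume y: "\<bar>y\<bar> = l * h" and x: "\<bar>x - a\<bar> \<le> l * r (y / l)"
    define z where "z = y / l"
    have z: "\<bar>z\<bar> = h" "y = l * z"
      using y l by (auto simp: z_def abs_divide)
    then have "z = h \<or> z = - h"
      by linarith
    then have rz: "r (y / l) = ?\<rho>"
      unfolding z_def[symmetric] using rh by blast
    have l\<rho>: "l * ?\<rho> \<le> ?\<rho>"
      using l \<rho>(1) by simp
    have x\<rho>: "\<bar>x - a\<bar> \<le> ?\<rho>"
      using x l\<rho> unfolding rz by simp
    have lh: "l * h \<le> h"
      using l h0 by simp
    have "dist (x, y) (x, z) = \<bar>z - y\<bar>"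
      by (simp add: dist_Pair_Pair dist_real_def)
    also have "z - y = (1 - l) * z"
      by (simp add: z(2) algebra_simps)
    also have "\<bar>(1 - l) * z\<bar> = h - l * h"
      unfolding abs_mult z(1) using l by (simp add: left_diff_distrib)
    finally have "dist (x, y) (x, z) < \<delta>"
      using l\<delta> by simp
    then have "dist (v (x, y)) (v (x, z)) < e"
      using x\<rho> y z(1) lh by (intro \<delta>(2)) (auto simp: K_def abs_le_iff)
    then have "f x - e \<le> v (x, y)"
      using vf[OF z(1)] by (simp add: dist_real_def)
    \<comment> \<open>Over its ends the shrunken nodoid is a half circle below that of radius
      \<open>?\<rho>\<close>, hence below \<open>f\<close>; lowering it by \<open>e\<close> absorbs
      the oscillation of \<open>v\<close> between end and edge.\<close>
    moreover have "b + sqrt ((l * ?\<rho>)\<^sup>2 - (x - a)\<^sup>2) \<le> b + sqrt (?\<rho>\<^sup>2 - (x - a)\<^sup>2)"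
      using l\<rho> l \<rho>(1) by (simp add: power_mono)
    ultimately show "b - e + sqrt ((l * r (y / l))\<^sup>2 - (x - a)\<^sup>2) \<le> v (x, y)"
      using disc[OF x\<rho>] unfolding rz by linarith
  qed
  moreover have "0 \<le> sqrt ((l * r (y0 / l))\<^sup>2 - (x0 - a)\<^sup>2)"
  proof -
    have "y0 / l \<in> {- h..h}"
      using ly l by (auto simp: field_simps abs_less_iff)
    then have "l * t \<le> l * r (y0 / l)"
      using rt l by simp
    then have "\<bar>x0 - a\<bar>\<^sup>2 \<le> (l * r (y0 / l))\<^sup>2"
      using lx by (intro power_mono) auto
    then show ?thesis
      by simp
  qed
  ultimately show "b \<le> v (x0, y0) + e"
    by linarith
qed

text \<open>Take the exterior disc at the graph point over \<open>x0\<close>. A point of its upper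
  arc strictly above the graph would lie in the epigraph, hence be the contact point, which is on
  the graph.\<close>

lemma circle_under:
  fixes f :: "real \<Rightarrow> real"
  assumes cf: "continuous_on UNIV f" and circ: "uniform_circle_under R f"
  obtains a b where "\<bar>x0 - a\<bar> \<le> R" "f x0 \<le> b + R"
    "\<And>x. \<bar>x - a\<bar> \<le> R \<Longrightarrow> b + sqrt (R\<^sup>2 - (x - a)\<^sup>2) \<le> f x"
proof -
  define U where "U = {(x, y). f x \<le> y}"
  have "U = (\<lambda>p. snd p - f (fst p)) -` {0..}"
    by (auto simp: U_def)
  then have "closed U"
    using cf by (auto intro!: closed_vimage continuous_intros continuous_on_compose2[OF cf])
  have "(x0, f x0) \<notin> interior U"
  proof
    assume "(x0, f x0) \<in> interior U"
    then obtain e where e: "0 < e" "ball (x0, f x0) e \<subseteq> U"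
      unfolding mem_interior by blast
    have "(x0, f x0 - e / 2) \<in> ball (x0, f x0) e"
      using e(1) by (simp add: dist_Pair_Pair dist_real_def)
    then show False
      using e by (auto simp: U_def)
  qed
  then have "(x0, f x0) \<in> frontier U"
    using \<open>closed U\<close> by (simp add: frontier_def U_def)
  then obtain c where c: "cball c R \<inter> closure U = {(x0, f x0)}"
    using circ unfolding uniform_circle_under_def uniform_exterior_circle_def U_def by blast
  obtain a b where ab: "c = (a, b)"
    by (cases c)
  have cU: "cball (a, b) R \<inter> U = {(x0, f x0)}"
    using c \<open>closed U\<close> by (simp add: ab)
  have "dist (a, b) (x0, f x0) \<le> R"
    using cU by auto
  then have d: "\<bar>x0 - a\<bar> \<le> R" "\<bar>f x0 - b\<bar> \<le> R"
    using dist_fst_le[of "(a, b)" "(x0, f x0)"] dist_snd_le[of "(a, b)" "(x0, f x0)"]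
    by (auto simp: dist_real_def)
  moreover have "b + sqrt (R\<^sup>2 - (x - a)\<^sup>2) \<le> f x" if x: "\<bar>x - a\<bar> \<le> R" for x
  proof (rule ccontr)
    define y where "y = b + sqrt (R\<^sup>2 - (x - a)\<^sup>2)"
    assume "\<not> b + sqrt (R\<^sup>2 - (x - a)\<^sup>2) \<le> f x"
    then have lt: "f x < y"
      by (simp add: y_def)
    have R: "0 \<le> R"
      using x by linarith
    have "(x - a)\<^sup>2 \<le> R\<^sup>2"
      using power_mono[OF x, of 2] by simp
    then have "dist (a, b) (x, y) = R"
      using R by (simp add: dist_Pair_Pair dist_real_def y_def power2_commute[of a x])
    then have "(x, y) \<in> cball (a, b) R \<inter> U"
      using lt by (simp add: U_def)
    then have "(x, y) = (x0, f x0)"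
      using cU by blast
    then show False
      using lt by simp
  qed
  ultimately show thesis
    using that by (smt (verit))
qed

text \<open>
  If \<open>F\<close> has no far away near-maxima over windows of half-width \<open>L\<close>, then from every far away point
  one can keep climbing by a fixed amount in steps of length at most \<open>L\<close>. If the growth of \<open>F\<close> is at
  most linear, this is only possible by going back to where \<open>F\<close> is bounded.
\<close>

lemma growth_trichotomy:
  fixes F :: "real \<Rightarrow> real"
  assumes cF: "continuous_on UNIV F" and L: "0 < L"
  shows "(\<exists>C. \<forall>M. \<exists>x\<ge>M. \<forall>z. \<bar>z - x\<bar> \<le> L \<longrightarrow> F z \<le> F x + C) \<or>
    (\<forall>C M. \<exists>x\<ge>M. C * x \<le> F x) \<or> (\<forall>C. \<exists>X. \<forall>x\<ge>X. F x \<le> - C * x)"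
proof (rule ccontr)
  assume "\<not> ?thesis"
  then have bad: "\<And>C. \<exists>X. \<forall>x\<ge>X. \<exists>z. \<bar>z - x\<bar> \<le> L \<and> F x + C < F z"
    and lin: "\<exists>C M. \<forall>x\<ge>M. F x < C * x"
    and dec: "\<exists>C. \<forall>X. \<exists>x\<ge>X. - C * x < F x"
    by (meson not_le)+
  obtain C1 M1 where lin: "\<And>x. M1 \<le> x \<Longrightarrow> F x < C1 * x"
    using lin by blast
  obtain C2 where dec: "\<And>X. \<exists>x\<ge>X. - C2 * x < F x"
    using dec by blast
  \<comment> \<open>A climb at slope \<open>K\<close> outruns the growth bound \<open>C1\<close>,
    and a decay at slope \<open>K\<close> falls below \<open>- C2 * x\<close>.\<close>
  define K where "K = \<bar>C1\<bar> + \<bar>C2\<bar> + 1"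
  obtain X0 where X0: "\<And>x. X0 \<le> x \<Longrightarrow> \<exists>z. \<bar>z - x\<bar> \<le> L \<and> F x + K * L < F z"
    using bad[of "K * L"] by blast
  define X where "X = max 0 (max X0 M1)"
  have X: "0 \<le> X" "X0 \<le> X" "M1 \<le> X"
    by (auto simp: X_def)
  have "\<exists>y\<in>{X..X + L}. \<forall>x\<in>{X..X + L}. F x \<le> F y"
    using L by (intro continuous_attains_sup continuous_on_subset[OF cF]) auto
  then obtain M0 where M0: "\<And>x. X \<le> x \<Longrightarrow> x \<le> X + L \<Longrightarrow> F x \<le> M0"
    by (metis atLeastAtMost_iff)
  have "F x \<le> M0 - K * (x - X - L)" if x: "X + L \<le> x" for x
  proof (rule ccontr)
    assume "\<not> F x \<le> M0 - K * (x - X - L)"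
    then have gt: "M0 - K * (x - X - L) < F x"
      by simp
    \<comment> \<open>Each step moves by at most \<open>L\<close> and gains at least
      \<open>K * L\<close>. It is too short to jump over the window from \<open>X\<close> to
      \<open>X + L\<close>, and inside the window the accumulated gain would exceed
      \<open>M0\<close>.\<close>
    have chain: "\<exists>z\<ge>X + L. \<bar>z - x\<bar> \<le> k * L \<and> F x + k * (K * L) \<le> F z" for k :: nat
    proof (induction k)
      case 0
      show ?case
        using x by (intro exI[of _ x]) simp
    next
      case (Suc k)
      then obtain z where z: "X + L \<le> z" "\<bar>z - x\<bar> \<le> k * L" "F x + k * (K * L) \<le> F z"
        by blast
      obtain z' where z': "\<bar>z' - z\<bar> \<le> L" "F z + K * L < F z'"
        using X0[of z] z(1) X L by auto
      have s1: "\<bar>z' - x\<bar> \<le> Suc k * L" and s2: "F x + Suc k * (K * L) \<le> F z'"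
        using z z' by (auto simp: algebra_simps)
      have "X + L \<le> z'"
      proof (rule ccontr)
        assume "\<not> X + L \<le> z'"
        then have "F z' \<le> M0" and lt: "z' < X + L"
          using M0[of z'] z(1) z'(1) by auto
        moreover have "K * (x - X - L) \<le> K * (Suc k * L)"
          using s1 lt by (intro mult_left_mono) (auto simp: K_def)
        ultimately show False
          using gt s2 by (simp add: mult.left_commute)
      qed
      then show ?case
        using s1 s2 by blast
    qed
    \<comment> \<open>Along the chain \<open>F\<close> stays below the line of slope
      \<open>C1\<close>, so the surplus of at least \<open>L\<close> per step is bounded
      independently of the number of steps.\<close>
    have small: "k * L < C1 * x - F x" if "0 < k" for k :: nat
    proof -
      obtain z where z: "X + L \<le> z" "\<bar>z - x\<bar> \<le> k * L" "F x + k * (K * L) \<le> F z"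
        using chain by blast
      have "F z < C1 * z"
        using z(1) X L by (intro lin) auto
      also have "C1 * z = C1 * x + C1 * (z - x)"
        by (simp add: algebra_simps)
      also have "C1 * (z - x) \<le> \<bar>C1\<bar> * (k * L)"
        using z(2) by (metis abs_ge_self abs_ge_zero abs_mult mult_left_mono order_trans)
      finally have "k * (K * L) - \<bar>C1\<bar> * (k * L) < C1 * x - F x"
        using z(3) by linarith
      moreover have "k * (K * L) - \<bar>C1\<bar> * (k * L) = k * L + \<bar>C2\<bar> * (k * L)"
        by (simp add: K_def algebra_simps)
      moreover have "0 \<le> \<bar>C2\<bar> * (k * L)"
        using L by simp
      ultimately show ?thesis
        by linarith
    qed
    obtain k :: nat where k: "\<bar>C1 * x - F x\<bar> < k * L"
      using reals_Archimedean3[OF L] by blast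
    then have "0 < k"
      using L by (cases k) auto
    from small[OF this] k show False
      by linarith
  qed
  note decay = this
  define X' where "X' = max (X + L) (M0 + K * (X + L))"
  obtain x where x: "X' \<le> x" "- C2 * x < F x"
    using dec by blast
  have x': "X + L \<le> x" "M0 + K * (X + L) \<le> x" "0 \<le> x"
    using x(1) X L by (auto simp: X'_def)
  have "F x \<le> M0 + K * (X + L) - K * x"
    using decay[OF x'(1)] by (simp add: algebra_simps)
  moreover have "K * x = \<bar>C1\<bar> * x + \<bar>C2\<bar> * x + x"
    by (simp add: K_def algebra_simps)
  moreover have "0 \<le> \<bar>C1\<bar> * x" "C2 * x \<le> \<bar>C2\<bar> * x"
    using x'(3) by (auto intro: mult_right_mono)
  ultimately show False
    using x(2) x'(2) by simp
qed

text \<open>The barriers act asymmetrically: one value of \<open>f\<close> controls \<open>v\<close>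
  on a whole slab nearby, while a bound for \<open>u\<close> takes \<open>f\<close> on a whole
  window. This is why the trichotomy asks for growth only at some far points but for decay at all of
  them.\<close>

lemma solution_le:
  fixes u v :: "real \<times> real \<Rightarrow> real"
  assumes H: "0 < H" and t: "0 < t" and cf: "continuous_on UNIV f"
    and circ: "uniform_circle_under (rho t H) f"
    and \<Omega>: "\<Omega> = UNIV \<times> {- half_width t H <..< half_width t H}"
    and \<phi>: "\<And>x. \<phi> (x, half_width t H) = f x" "\<And>x. \<phi> (x, - half_width t H) = f x"
    and u: "cmc_solution H \<Omega> \<phi> u" and v: "cmc_solution H \<Omega> \<phi> v" and p: "p \<in> closure \<Omega>"
  shows "u p \<le> v p"
proof -
  define h where "h = half_width t H"
  interpret nodoid H t "rho t H"
    by unfold_locales (use H t in auto)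
  let ?\<rho> = "rho t H" and ?R = "2 / H"
  have hb: "0 < h" "h \<le> ?R"
    using half_width_bounds H unfolding h_def[symmetric]
    by (auto intro: order_trans simp: field_simps)
  have Oh: "\<Omega> = UNIV \<times> {- h<..<h}"
    by (simp add: \<Omega> h_def)
  have opn: "open \<Omega>"
    unfolding Oh by (simp add: open_Times)
  obtain Gu Bu where gu: "graph_on \<Omega> u Gu Bu" and eu: "\<And>p. p \<in> \<Omega> \<Longrightarrow> graph_div (Gu p) (Bu p) = 2 * H"
    using cmc_graph_on[OF opn] u unfolding cmc_solution_def by blast
  obtain Gv Bv where gv: "graph_on \<Omega> v Gv Bv" and ev: "\<And>p. p \<in> \<Omega> \<Longrightarrow> graph_div (Gv p) (Bv p) = 2 * H"
    using cmc_graph_on[OF opn] v unfolding cmc_solution_def by blast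
  have cu: "continuous_on (closure \<Omega>) u" and cv: "continuous_on (closure \<Omega>) v"
    using u v unfolding cmc_solution_def by auto
  have bd: "u p = v p" if "p \<in> frontier \<Omega>" for p
    using u v that unfolding cmc_solution_def by auto
  have main: "u p - v p \<le> d" if d: "0 < d" for d
  proof -
    interpret two_graphs h d \<Omega> u v Gu Gv Bu Bv
      by unfold_locales (use hb d Oh cu cv bd gu gv eu ev in auto)
    have frontier_f: "u q = f (fst q)" "v q = f (fst q)" if "q \<in> frontier \<Omega>" for q
    proof -
      have "\<phi> q = f (fst q)"
        using that \<phi> unfolding frontier_dom h_def by (cases q) auto
      then show "u q = f (fst q)" "v q = f (fst q)"
        using u v that unfolding cmc_solution_def by auto
    qed
    have v_edge: "v (x, y) = f x" if "\<bar>y\<bar> = h" for x y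
      using frontier_f(2)[of "(x, y)"] that by (auto simp: frontier_dom abs_if split: if_splits)
    have upper: "u q \<le> M + ?R" if "q \<in> \<Omega>" "\<And>z. \<bar>z - fst q\<bar> \<le> ?R \<Longrightarrow> f z \<le> M" for q M
      by (rule upper_barrier[OF H hb Oh cu gu eu _ that(1) refl]) (use that(2) frontier_f(1) in auto)
    have lower: "\<exists>a. \<bar>a - x\<bar> \<le> ?\<rho> \<and> (\<forall>q\<in>\<Omega>. \<bar>fst q - a\<bar> \<le> t / 2 \<longrightarrow> f x - ?\<rho> \<le> v q)" for x
    proof -
      obtain a b where ab: "\<bar>x - a\<bar> \<le> ?\<rho>" "f x \<le> b + ?\<rho>"
        "\<And>z. \<bar>z - a\<bar> \<le> ?\<rho> \<Longrightarrow> b + sqrt (?\<rho>\<^sup>2 - (z - a)\<^sup>2) \<le> f z"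
        using circle_under[OF cf circ] by metis
      have "b \<le> v q" if q: "q \<in> \<Omega>" "\<bar>fst q - a\<bar> \<le> t / 2" for q
        using lower_barrier[OF H t h_def Oh cv gv ev v_edge ab(3), of "fst q" "snd q"] q t by auto
      then show ?thesis
        using ab(1,2) by (intro exI[of _ a]) (force simp: abs_minus_commute)
    qed
    have "\<exists>M k K. cutoff s N M e k K" if s: "s = 1 \<or> s = - 1" and N: "0 \<le> N" and e: "0 < e" for s N e
    proof -
      have t2: "0 < t / 2"
        using t by simp
      have ss: "s * (s * x) = x" "\<bar>s * x\<bar> = \<bar>x\<bar>" for x
        using s by auto
      have sd: "\<bar>s * x - y\<bar> = \<bar>s * y - x\<bar>" for x y
        using s by auto
      have "continuous_on UNIV (\<lambda>x. f (s * x))"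
        by (rule continuous_on_compose2[OF cf]) (auto intro!: continuous_intros)
      \<comment> \<open>The slab for \<open>v\<close> is centred within \<open>?\<rho>\<close> of
        the chosen point and has half-width \<open>t / 2\<close>, safely below the strict limit
        \<open>t\<close> of \<open>lower_barrier\<close>; the hemispheres look \<open>?R\<close>
        further.\<close>
      moreover have "0 < ?\<rho> + t / 2 + ?R"
        using \<rho>(1) t H by (intro add_pos_pos) auto
      ultimately consider
          (A) C where "\<And>M. \<exists>x\<ge>M. \<forall>z. \<bar>z - x\<bar> \<le> ?\<rho> + t / 2 + ?R \<longrightarrow> f (s * z) \<le> f (s * x) + C"
        | (B) "\<And>C M. \<exists>x\<ge>M. C * x \<le> f (s * x)"
        | (C) "\<And>C. \<exists>X. \<forall>x\<ge>X. f (s * x) \<le> - C * x"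
        using growth_trichotomy[of "\<lambda>x. f (s * x)" "?\<rho> + t / 2 + ?R"] by blast
      then show ?thesis
      proof cases
        case A
        define C' where "C' = max 0 (C + ?R + ?\<rho>)"
        have "\<exists>a. M \<le> s * a \<and> (\<forall>q\<in>\<Omega>. \<bar>fst q - a\<bar> \<le> t / 2 \<longrightarrow> diff q \<le> C')" for M
        proof -
          obtain x where x: "M + ?\<rho> \<le> x"
            "\<And>z. \<bar>z - x\<bar> \<le> ?\<rho> + t / 2 + ?R \<Longrightarrow> f (s * z) \<le> f (s * x) + C"
            using A by blast
          obtain a where a: "\<bar>a - s * x\<bar> \<le> ?\<rho>"
            and va: "\<And>q. q \<in> \<Omega> \<Longrightarrow> \<bar>fst q - a\<bar> \<le> t / 2 \<Longrightarrow> f (s * x) - ?\<rho> \<le> v q"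
            using lower by blast
          have "diff q \<le> C'" if q: "q \<in> \<Omega>" "\<bar>fst q - a\<bar> \<le> t / 2" for q
          proof -
            have "u q \<le> (f (s * x) + C) + ?R"
            proof (rule upper[OF q(1)])
              fix z assume "\<bar>z - fst q\<bar> \<le> ?R"
              then have "\<bar>s * x - z\<bar> \<le> ?\<rho> + t / 2 + ?R"
                using q(2) a by linarith
              then show "f z \<le> f (s * x) + C"
                using x(2)[of "s * z"] unfolding sd[of x z] ss by blast
            qed
            then show ?thesis
              using va[OF q] by (simp add: diff_def C'_def)
          qed
          moreover have "M \<le> s * a"
            using a x(1) s by (auto simp: abs_le_iff)
          ultimately show ?thesis
            by blast
        qed
        from cutoff_bounded_slabs[OF s t2 e N _ this] show ?thesis
          by (simp add: C'_def)
      next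
        case B
        have gX: "Gv q \<bullet> X q \<le> 1" for q
          unfolding X_def by (rule inner_nmap_diff_le)
        have gv': "GDERIV v q :> Gv q" if "q \<in> \<Omega>" for q
          using gv that by (simp add: graph_on_def)
        have "\<exists>a. M \<le> s * a \<and> (\<forall>q\<in>\<Omega>. \<bar>fst q - a\<bar> \<le> t / 2 \<longrightarrow> C * \<bar>a\<bar> \<le> v q)" for C M
        proof -
          \<comment> \<open>The surplus slope 1 pays for the shift of the slab by up to
            \<open>?\<rho>\<close> and for the loss of \<open>?\<rho>\<close> in
            \<open>lower\<close>.\<close>
          obtain x where x: "max (max (M + ?\<rho>) 0) (?\<rho> + \<bar>C\<bar> * ?\<rho>) \<le> x" "(\<bar>C\<bar> + 1) * x \<le> f (s * x)"
            using B by blast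
          obtain a where a: "\<bar>a - s * x\<bar> \<le> ?\<rho>"
            and va: "\<And>q. q \<in> \<Omega> \<Longrightarrow> \<bar>fst q - a\<bar> \<le> t / 2 \<Longrightarrow> f (s * x) - ?\<rho> \<le> v q"
            using lower by blast
          have "\<bar>a\<bar> \<le> x + ?\<rho>"
            using a x(1) s by (auto simp: abs_le_iff)
          then have "C * \<bar>a\<bar> \<le> \<bar>C\<bar> * (x + ?\<rho>)"
            by (intro mult_mono) auto
          also have "\<dots> \<le> f (s * x) - ?\<rho>"
            using x by (simp add: algebra_simps)
          finally have "C * \<bar>a\<bar> \<le> f (s * x) - ?\<rho>" .
          moreover have "M \<le> s * a"
            using a x(1) s by (auto simp: abs_le_iff)
          ultimately show ?thesis
            using va by (meson order_trans)
        qed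
        from cutoff_superlinear[OF s t2 e N gv' contG(2) cv gX this] show ?thesis .
      next
        case C
        have gX: "- Gu q \<bullet> X q \<le> 1" for q
          using inner_nmap_diff_le[of "Gu q" "Gv q"] by (simp add: X_def inner_diff_right)
        have gu': "GDERIV (\<lambda>q. - u q) q :> - Gu q" if "q \<in> \<Omega>" for q
          using gu that by (intro GDERIV_minus) (simp add: graph_on_def)
        have "\<exists>a. M \<le> s * a \<and> (\<forall>q\<in>\<Omega>. \<bar>fst q - a\<bar> \<le> t / 2 \<longrightarrow> C * \<bar>a\<bar> \<le> - u q)" for C M
        proof -
          \<comment> \<open>The surplus slope 1 pays for the window \<open>w\<close> and for the
            height \<open>?R\<close> of the hemisphere.\<close>
          define D where "D = \<bar>C\<bar> + 1"
          define w where "w = t / 2 + ?R"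
          obtain Y where Y: "\<And>x. Y \<le> x \<Longrightarrow> f (s * x) \<le> - D * x"
            using C by blast
          define x where "x = max (max M 0) (max (Y + w) (D * w + ?R))"
          have x: "M \<le> x" "0 \<le> x" "Y + w \<le> x" "D * w + ?R \<le> x"
            by (auto simp: x_def)
          have "C * \<bar>s * x\<bar> \<le> - u q" if q: "q \<in> \<Omega>" "\<bar>fst q - s * x\<bar> \<le> t / 2" for q
          proof -
            have "u q \<le> - D * (x - w) + ?R"
            proof (rule upper[OF q(1)])
              fix z assume "\<bar>z - fst q\<bar> \<le> ?R"
              then have "\<bar>s * x - z\<bar> \<le> w"
                using q(2) unfolding w_def by linarith
              then have z: "x - w \<le> s * z"
                unfolding sd[of x z] by linarith
              then have "f (s * (s * z)) \<le> - D * (s * z)"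
                using x(3) by (intro Y) linarith
              also have "\<dots> \<le> - D * (x - w)"
                using z by (intro mult_left_mono_neg) (auto simp: D_def)
              finally show "f z \<le> - D * (x - w)"
                unfolding ss .
            qed
            moreover have "C * x \<le> \<bar>C\<bar> * x"
              using x(2) by (intro mult_right_mono) auto
            moreover have "D * (x - w) - ?R = \<bar>C\<bar> * x + (x - D * w - ?R)"
              by (simp add: D_def algebra_simps)
            ultimately show ?thesis
              unfolding ss abs_of_nonneg[OF x(2)] using x(4) by simp
          qed
          then show ?thesis
            using x(1) by (intro exI[of _ "s * x"]) (auto simp: ss)
        qed
        from cutoff_superlinear[OF s t2 e N gu' _ _ gX this] show ?thesis
          by (simp add: continuous_intros contG cu)
      qed
    qed
    then show ?thesis
      using diff_le[OF _ p] by (simp add: diff_def)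
  qed
  show ?thesis
  proof (rule field_le_epsilon)
    fix d :: real assume "0 < d"
    from main[OF this] show "u p \<le> v p + d"
      by linarith
  qed
qed

theorem theorem12:
  fixes H t :: real
    and f :: "real \<Rightarrow> real"
    and \<Omega> :: "(real \<times> real) set"
    and \<phi> u v :: "real \<times> real \<Rightarrow> real"
  assumes "H > 0" and "t > 0"
    and "continuous_on UNIV f"
    and "uniform_circle_under (rho t H) f"
    and "\<Omega> = UNIV \<times> {- half_width t H <..< half_width t H}"
    and "\<And>x. \<phi> (x, half_width t H) = f x"
    and "\<And>x. \<phi> (x, - half_width t H) = f x"
    and "cmc_solution H \<Omega> \<phi> u"
    and "cmc_solution H \<Omega> \<phi> v"
  shows "\<forall>p\<in>closure \<Omega>. u p = v p"
proof
  fix p assume p: "p \<in> closure \<Omega>"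
  show "u p = v p"
    by (rule antisym[OF solution_le[OF assms p] solution_le[OF assms(1-7) assms(9) assms(8) p]])
qed

end
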